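(* Let $r>1$ be an integer and let $\mu_{r,r-1}=R_{2,1}\boxtimes R_{1,\frac12}^{\boxtimes (r-1)}$. Define $$c_r=\frac{3r-\sqrt{r^2+8}}{2(r-1)}\in(1,2),\qquad x_{r,r-1}^{\ast}=\frac{c_r^{\,r+1}}{2^r(c_r-1)(2-c_r)}>0,$$ and, for $0<\varphi<\frac{\pi}{r+1}$, $$\rho_r(\varphi)=\frac{3\sin(r\varphi)}{2\sin((r-1)\varphi)}-\sqrt{\left(\frac{3\sin(r\varphi)}{2\sin((r-1)\varphi)}\right)^2-\frac{2\sin((r+1)\varphi)}{\sin((r-1)\varphi)}} .$$ Then the measure $\mu_{r,r-1}$ is supported on the interval $[0,x_{r,r-1}^{\ast}]$ and has the density $$\frac{d\mu_{r,r-1}}{dx}(x)=\frac{2^{r+1}\sin(\varphi)\left(3\sin(\varphi)-\rho_r(\varphi)\sin(2\varphi)\right)}{\pi\,\sin((r+1)\varphi)\,\rho_r(\varphi)^{r-1}\left(4-4\rho_r(\varphi)\cos(\varphi)+\rho_r(\varphi)^2\right)},$$ where the spectral variable $x$ is parameterized by $$x=x(\varphi)=\frac{\rho_r(\varphi)^r\sin((r+1)\varphi)}{2^r\left(3\sin(\varphi)-\rho_r(\varphi)\sin(2\varphi)\right)},\qquad 0<\varphi<\frac{\pi}{r+1}.$$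
   Context: Raney distributions: for real parameters $\alpha\geq 1$ and $0<\beta\leq\alpha$, $R_{\alpha,\beta}$ is the compactly supported probability measure on $[0,\infty)$ with moments $$R_{\alpha,\beta}(k)=\frac{\beta}{k\alpha+\beta}\binom{k\alpha+\beta}{k},\qquad k=0,1,2,\ldots$$ In particular $R_{2,1}$ is the Marchenko-Pastur distribution on $[0,4]$ with density $\frac{1}{2\pi}\frac{\sqrt{4-x}}{\sqrt{x}}$, and $R_{1,\frac12}$ is the arcsine distribution on $[0,1]$ with density $\frac{1}{\pi\sqrt{x(1-x)}}$. The symbol $\boxtimes$ denotes free multiplicative convolution, and $R_{1,\frac12}^{\boxtimes(r-1)}$ is the $(r-1)$-fold free multiplicative convolution power. The measure $\mu_{r,r-1}$ is the limiting distribution of the rescaled squared singular values of products $G_rT_{r-1}\cdots T_1$ of one complex Ginibre matrix $G_r$ and $r-1$ truncated Haar unitary matrices $T_j$. *)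

theory Defs
  imports
    "HOL-Probability.Probability"
    "HOL-Computational_Algebra.Polynomial"
    "HOL-Library.Poly_Mapping"
begin

section \<open>Non-commutative polynomials and freeness\<close>

text \<open>
  Words in letters from \<open>'i\<close> form the free monoid, written additively so that the
  multiplication of \<open>HOL-Library.Poly_Mapping\<close> becomes that of the free unital complex
  algebra on \<open>'i\<close>.
\<close>

datatype 'i free_monoid = Word (letters: "'i list")

instantiation free_monoid :: (type) monoid_add
begin

definition zero_free_monoid :: "'a free_monoid" where
  "0 = Word []"

definition plus_free_monoid :: "'a free_monoid \<Rightarrow> 'a free_monoid \<Rightarrow> 'a free_monoid" where
  "u + v = Word (letters u @ letters v)"

instance
  by standard (auto simp: zero_free_monoid_def plus_free_monoid_def)

end

type_synonym 'i nc_poly = "'i free_monoid \<Rightarrow>\<^sub>0 complex"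

definition nc_const :: "complex \<Rightarrow> 'i nc_poly" where
  "nc_const c = Poly_Mapping.single 0 c"

definition nc_var :: "'i \<Rightarrow> 'i nc_poly" where
  "nc_var i = Poly_Mapping.single (Word [i]) 1"

definition nc_eval :: "complex poly \<Rightarrow> 'i nc_poly \<Rightarrow> 'i nc_poly" where
  "nc_eval p a = (\<Sum>k\<le>Polynomial.degree p. nc_const (coeff p k) * a ^ k)"

text \<open>
  Unital linear functionals on the free algebra.  A family \<open>(a\<^sub>i)\<close> in an arbitrary
  non-commutative probability space \<open>(\<A>, \<tau>)\<close> gives rise to such a functional, its joint
  distribution \<open>p \<mapsto> \<tau> (p((a\<^sub>i)))\<close>; conversely the free algebra with such a functional is a
  non-commutative probability space in its own right.  Freeness and the moments of products
  depend on the joint distribution only.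
\<close>

definition nc_distribution :: "('i nc_poly \<Rightarrow> complex) \<Rightarrow> bool" where
  "nc_distribution \<phi> \<longleftrightarrow>
     (\<forall>p q. \<phi> (p + q) = \<phi> p + \<phi> q) \<and>
     (\<forall>c p. \<phi> (nc_const c * p) = c * \<phi> p) \<and>
     \<phi> 1 = 1"

text \<open>
  Voiculescu's freeness of the unital subalgebras generated by the single variables: products
  of centred elements taken from alternating subalgebras are centred.
\<close>

definition free_distribution :: "('i nc_poly \<Rightarrow> complex) \<Rightarrow> bool" where
  "free_distribution \<phi> \<longleftrightarrow>
     (\<forall>fs :: ('i \<times> complex poly) list.
        fs \<noteq> [] \<and> distinct_adj (map fst fs) \<and>
        (\<forall>(i, p) \<in> set fs. \<phi> (nc_eval p (nc_var i)) = 0) \<longrightarrow>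
        \<phi> (prod_list (map (\<lambda>(i, p). nc_eval p (nc_var i)) fs)) = 0)"


section \<open>Free multiplicative convolution\<close>

definition compact_law :: "real measure \<Rightarrow> bool" where
  "compact_law \<mu> \<longleftrightarrow>
     prob_space \<mu> \<and> sets \<mu> = sets borel \<and> (\<exists>b. AE x in \<mu>. 0 \<le> x \<and> x \<le> b)"

definition moment :: "real measure \<Rightarrow> nat \<Rightarrow> real" where
  "moment \<mu> n = (\<integral>x. x ^ n \<partial>\<mu>)"

text \<open>
  \<open>is_free_mult_conv \<mu> \<nu> \<rho>\<close> states \<open>\<rho> = \<mu> \<boxtimes> \<nu>\<close>: \<open>\<rho>\<close> is the distribution of \<open>ab\<close> for free variables
  \<open>a\<close>, \<open>b\<close> with distributions \<open>\<mu>\<close>, \<open>\<nu>\<close>.  The joint distribution of \<open>(a, b)\<close> is determined by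
  freeness and the two marginals, and it is tracial, so that \<open>ab\<close> has the same moments as the
  positive elements \<open>a\<^sup>\<half> b a\<^sup>\<half>\<close> and \<open>b\<^sup>\<half> a b\<^sup>\<half>\<close>; being compactly supported,
  \<open>\<rho>\<close> is determined by its moments.
\<close>

definition is_free_mult_conv :: "real measure \<Rightarrow> real measure \<Rightarrow> real measure \<Rightarrow> bool" where
  "is_free_mult_conv \<mu> \<nu> \<rho> \<longleftrightarrow>
     compact_law \<mu> \<and> compact_law \<nu> \<and> compact_law \<rho> \<and>
     (\<exists>\<phi> :: bool nc_poly \<Rightarrow> complex.
        nc_distribution \<phi> \<and> free_distribution \<phi> \<and>
        (\<forall>n. \<phi> (nc_var False ^ n) = of_real (moment \<mu> n)) \<and>
        (\<forall>n. \<phi> (nc_var True ^ n) = of_real (moment \<nu> n)) \<and>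
        (\<forall>n. \<phi> ((nc_var False * nc_var True) ^ n) = of_real (moment \<rho> n)))"

text \<open>\<open>is_free_mult_power \<mu> n \<rho>\<close> states that \<open>\<rho>\<close> is the \<open>n\<close>-fold power of \<open>\<mu>\<close>, for \<open>n \<ge> 1\<close>.\<close>

inductive is_free_mult_power :: "real measure \<Rightarrow> nat \<Rightarrow> real measure \<Rightarrow> bool" for \<mu> where
  one: "is_free_mult_power \<mu> 1 \<mu>"
| Suc: "is_free_mult_power \<mu> n \<nu> \<Longrightarrow> is_free_mult_conv \<mu> \<nu> \<rho> \<Longrightarrow> is_free_mult_power \<mu> (Suc n) \<rho>"


section \<open>Raney distributions\<close>

definition is_raney :: "real \<Rightarrow> real \<Rightarrow> real measure \<Rightarrow> bool" where
  "is_raney \<alpha> \<beta> \<mu> \<longleftrightarrow>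
     1 \<le> \<alpha> \<and> 0 < \<beta> \<and> \<beta> \<le> \<alpha> \<and> compact_law \<mu> \<and>
     (\<forall>k. moment \<mu> k = \<beta> / (real k * \<alpha> + \<beta>) * ((real k * \<alpha> + \<beta>) gchoose k))"


section \<open>Parameterization of the density\<close>

definition measure_support :: "real measure \<Rightarrow> real set" where
  "measure_support \<mu> = {x. \<forall>U. open U \<and> x \<in> U \<longrightarrow> 0 < emeasure \<mu> U}"

definition c_par :: "nat \<Rightarrow> real" where
  "c_par r = (3 * real r - sqrt (real r ^ 2 + 8)) / (2 * (real r - 1))"

definition x_star :: "nat \<Rightarrow> real" where
  "x_star r = c_par r ^ (r + 1) / (2 ^ r * (c_par r - 1) * (2 - c_par r))"

text \<open>
  For \<open>r \<ge> 2\<close> and \<open>0 < \<phi> < \<pi> / (r + 1)\<close> the radicand is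
  \<open>(sin\<^sup>2 (r \<phi>) + 8 sin\<^sup>2 \<phi>) / (4 sin\<^sup>2 ((r - 1) \<phi>)) > 0\<close>.
\<close>

definition rho :: "nat \<Rightarrow> real \<Rightarrow> real" where
  "rho r \<phi> =
     3 * sin (real r * \<phi>) / (2 * sin ((real r - 1) * \<phi>)) -
     sqrt ((3 * sin (real r * \<phi>) / (2 * sin ((real r - 1) * \<phi>))) ^ 2 -
           2 * sin ((real r + 1) * \<phi>) / sin ((real r - 1) * \<phi>))"

definition x_par :: "nat \<Rightarrow> real \<Rightarrow> real" where
  "x_par r \<phi> =
     rho r \<phi> ^ r * sin ((real r + 1) * \<phi>) /
     (2 ^ r * (3 * sin \<phi> - rho r \<phi> * sin (2 * \<phi>)))"

definition density_par :: "nat \<Rightarrow> real \<Rightarrow> real" where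
  "density_par r \<phi> =
     2 ^ (r + 1) * sin \<phi> * (3 * sin \<phi> - rho r \<phi> * sin (2 * \<phi>)) /
     (pi * sin ((real r + 1) * \<phi>) * rho r \<phi> ^ (r - 1) *
      (4 - 4 * rho r \<phi> * cos \<phi> + rho r \<phi> ^ 2))"

end

theory Submission
  imports Defs "HOL-Complex_Analysis.Complex_Analysis"
begin

text \<open>
  The argument has two halves, an algebraic computation of the moments of \<open>\<mu>\<close> and an analytic
  computation of the moments of the measure with the stated density.  Two compactly supported
  measures with equal moments coincide (\<open>compact_law_eqI\<close>, by uniqueness of characteristic
  functions).

  Write \<open>M\<^sub>\<nu>\<close> for the moment generating series of \<open>\<nu>\<close>.  If \<open>\<chi>\<^sub>\<nu>(w)\<close> is the power series with
  \<open>M\<^sub>\<nu>(\<chi>\<^sub>\<nu>(w)) = 1 + w\<close>, then multiplicativity of Voiculescu's S-transform says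
  \<open>w \<chi>\<^sub>\<rho> = \<chi>\<^sub>\<mu> \<chi>\<^sub>\<nu> (1 + w)\<close> for \<open>\<rho> = \<mu> \<boxtimes> \<nu>\<close>.  It is proved here
  (\<open>free_product_moment_series\<close>) by an idea of Haagerup: for free \<open>a\<close>, \<open>b\<close> and
  \<open>\<alpha> = \<chi>\<^sub>a(w)\<close>, \<open>\<beta> = \<chi>\<^sub>b(w)\<close>, \<open>\<zeta> = \<alpha>\<beta>(1 + w)/w\<close>, write \<open>1/(1 - \<alpha>a) = 1 + w + w A\<close> and
  \<open>1/(1 - \<beta>b) = 1 + w + w B\<close> with \<open>A\<close>, \<open>B\<close> centred.  Then
  \<open>1 - \<zeta>ab = (1 - \<alpha>a) (1 + w - w A B) (1 - \<beta>b)\<close>, so that \<open>1/(1 - \<zeta>ab)\<close> expands into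
  alternating products of \<open>A\<close> and \<open>B\<close>, which have expectation zero by freeness.  From the explicit
  series of \<open>R\<^bsub>2,1\<^esub>\<close> and \<open>R\<^bsub>1,1/2\<^esub>\<close> it follows that \<open>M\<^sub>\<mu>(\<chi>(w)) = 1 + w\<close> for
  \<open>\<chi>(w) = w (2 + w)^(r - 1) / (1 + w)^(r + 1)\<close>, and Lagrange inversion expresses the moment of order
  \<open>k\<close> as a residue at the origin of a rational function (\<open>lagrange_inversion\<close>, \<open>moment_kernel_expansion\<close>).

  On the analytic side put \<open>x(w) = 1/\<chi>(w)\<close>.  In the coordinate \<open>v = 2(1 + w)/(2 + w)\<close> the curve
  \<open>v = \<rho>\<^sub>r(\<phi>) e^(i\<phi>)\<close> consists of points of the upper half plane where \<open>x(w)\<close> is real; \<open>x\<close> and the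
  density become \<open>x(w)\<close> and \<open>Im w / (\<pi> x)\<close> there (\<open>curve_props\<close>).  The critical points of \<open>x(w)\<close>
  are real, so the derivative of \<open>\<phi> \<mapsto> x(\<phi>)\<close> never vanishes and \<open>x\<close> is a bijection onto
  \<open>(0, x\<^sup>*)\<close> (\<open>bij_betw_x_par\<close>).  Along the curve, \<open>x\<^sup>k\<close> times the density is the derivative in \<open>x\<close> of
  \<open>Im H / \<pi>\<close>, where \<open>H\<close> is a primitive of \<open>(1 + w) x(w)^(k - 1) x'(w)\<close>.  The curve ends at a positive
  real point and at \<open>w = -1\<close>, and \<open>Im H\<close> tends to \<open>0\<close> at the former and to \<open>\<pi>\<close> times the residue at
  the origin at the latter (\<open>primitive_half_residue\<close>).  This residue is minus the moment found before, so
  that integration from \<open>0\<close> to \<open>x\<^sup>*\<close> gives the moment.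
\<close>

unbundle no vec_syntax
unbundle fps_syntax

section \<open>Power series over the free algebra\<close>

lemma nc_const_0 [simp]: "nc_const 0 = 0"
  and nc_const_1 [simp]: "nc_const 1 = 1"
  by (simp_all add: nc_const_def flip: single_one)

lemma nc_const_add: "nc_const (a + b) = nc_const a + nc_const b"
  by (simp add: nc_const_def single_add)

lemma nc_const_mult: "nc_const (a * b) = nc_const a * nc_const b"
  by (simp add: nc_const_def mult_single)

lemma nc_const_sum: "nc_const (\<Sum>i\<in>I. f i) = (\<Sum>i\<in>I. nc_const (f i))"
  by (induction I rule: infinite_finite_induct) (simp_all add: nc_const_add)

lemma nc_const_commute: "x * nc_const c = nc_const c * x"
  for x :: "'i nc_poly"
proof (induction x rule: update_induct)
  case (update f k v)
  have "Poly_Mapping.update k v f = f + Poly_Mapping.single k v"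
    using update.hyps
    by (intro poly_mapping_eqI) (auto simp: lookup_add Poly_Mapping.lookup_update lookup_single in_keys_iff when_def)
  moreover have "Poly_Mapping.single k v * nc_const c = nc_const c * Poly_Mapping.single k v"
    by (simp add: nc_const_def mult_single mult.commute)
  ultimately show ?case
    by (simp add: update.IH distrib_left distrib_right)
qed simp

lemma nc_distribution_add: "nc_distribution \<phi> \<Longrightarrow> \<phi> (p + q) = \<phi> p + \<phi> q"
  and nc_distribution_scale: "nc_distribution \<phi> \<Longrightarrow> \<phi> (nc_const c * p) = c * \<phi> p"
  and nc_distribution_1: "nc_distribution \<phi> \<Longrightarrow> \<phi> 1 = 1"
  by (simp_all add: nc_distribution_def)

lemma nc_distribution_0: "nc_distribution \<phi> \<Longrightarrow> \<phi> 0 = 0"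
  using nc_distribution_scale[of \<phi> 0 0] by simp

lemma nc_distribution_sum:
  assumes "nc_distribution \<phi>"
  shows "\<phi> (\<Sum>i\<in>I. f i) = (\<Sum>i\<in>I. \<phi> (f i))"
  by (induction I rule: infinite_finite_induct)
     (simp_all add: nc_distribution_0[OF assms] nc_distribution_add[OF assms])

text \<open>The scalar power series as a central subring of the power series over the free algebra.\<close>

definition scalar_fps :: "complex fps \<Rightarrow> 'i nc_poly fps" where
  "scalar_fps s = Abs_fps (\<lambda>k. nc_const (s $ k))"

text \<open>A functional on the free algebra, applied to a power series coefficientwise.\<close>

definition apply_coeffs :: "('i nc_poly \<Rightarrow> complex) \<Rightarrow> 'i nc_poly fps \<Rightarrow> complex fps" where
  "apply_coeffs \<phi> F = Abs_fps (\<lambda>k. \<phi> (F $ k))"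

lemma scalar_fps_nth [simp]: "scalar_fps s $ k = nc_const (s $ k)"
  by (simp add: scalar_fps_def)

lemma apply_coeffs_nth [simp]: "apply_coeffs \<phi> F $ k = \<phi> (F $ k)"
  by (simp add: apply_coeffs_def)

lemma scalar_fps_1 [simp]: "scalar_fps 1 = 1" and scalar_fps_X: "scalar_fps fps_X = fps_X"
  by (rule fps_ext; simp)+

lemma scalar_fps_add: "scalar_fps (s + t) = scalar_fps s + scalar_fps t"
  by (rule fps_ext) (simp add: nc_const_add)

lemma scalar_fps_mult: "scalar_fps (s * t) = scalar_fps s * scalar_fps t"
  by (rule fps_ext) (simp add: fps_mult_nth nc_const_sum nc_const_mult)

lemma scalar_fps_commute: "F * scalar_fps s = scalar_fps s * F"
proof (rule fps_ext)
  fix k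
  have "(F * scalar_fps s) $ k = (\<Sum>i=0..k. nc_const (s $ (k - i)) * F $ i)"
    by (simp add: fps_mult_nth nc_const_commute)
  also have "\<dots> = (\<Sum>i=0..k. nc_const (s $ i) * F $ (k - i))"
    by (rule sum.reindex_bij_witness[of _ "\<lambda>i. k - i" "\<lambda>i. k - i"]) auto
  finally show "(F * scalar_fps s) $ k = (scalar_fps s * F) $ k"
    by (simp add: fps_mult_nth)
qed

lemma scalar_fps_left_commute: "F * (scalar_fps s * G) = scalar_fps s * (F * G)"
  by (simp only: scalar_fps_commute[of F] flip: mult.assoc)

lemma apply_coeffs_add: "nc_distribution \<phi> \<Longrightarrow> apply_coeffs \<phi> (F + G) = apply_coeffs \<phi> F + apply_coeffs \<phi> G"
  by (rule fps_ext) (simp add: nc_distribution_add)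

lemma apply_coeffs_0: "nc_distribution \<phi> \<Longrightarrow> apply_coeffs \<phi> 0 = 0"
  by (rule fps_ext) (simp add: nc_distribution_0)

lemma apply_coeffs_1: "nc_distribution \<phi> \<Longrightarrow> apply_coeffs \<phi> 1 = 1"
  by (rule fps_ext) (simp add: nc_distribution_0 nc_distribution_1)

lemma apply_coeffs_sum: "nc_distribution \<phi> \<Longrightarrow> apply_coeffs \<phi> (\<Sum>i\<in>I. f i) = (\<Sum>i\<in>I. apply_coeffs \<phi> (f i))"
  by (induction I rule: infinite_finite_induct) (simp_all add: apply_coeffs_0 apply_coeffs_add)

lemma apply_coeffs_scale: "nc_distribution \<phi> \<Longrightarrow> apply_coeffs \<phi> (scalar_fps s * F) = s * apply_coeffs \<phi> F"
  by (rule fps_ext) (simp add: fps_mult_nth nc_distribution_sum nc_distribution_scale)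

text \<open>The geometric series \<open>1 / (1 - s x)\<close>, for a scalar series \<open>s\<close> without constant term.\<close>

definition geometric_fps :: "complex fps \<Rightarrow> 'i nc_poly \<Rightarrow> 'i nc_poly fps" where
  "geometric_fps s x = Abs_fps (\<lambda>k. \<Sum>n\<le>k. nc_const ((s ^ n) $ k) * x ^ n)"

lemma geometric_fps_nth_upto:
  assumes "s $ 0 = 0" "k \<le> N"
  shows "geometric_fps s x $ k = (\<Sum>n\<le>N. nc_const ((s ^ n) $ k) * x ^ n)"
proof -
  have "(\<Sum>n\<le>k. nc_const ((s ^ n) $ k) * x ^ n) = (\<Sum>n\<le>N. nc_const ((s ^ n) $ k) * x ^ n)"
    by (rule sum.mono_neutral_left) (use assms in \<open>auto simp: startsby_zero_power_prefix\<close>)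
  then show ?thesis by (simp add: geometric_fps_def)
qed

lemma geometric_fps_eq_partial_sum:
  assumes "s $ 0 = 0" "k \<le> N"
  shows "geometric_fps s x $ k = (\<Sum>n\<le>N. (scalar_fps s * fps_const x) ^ n) $ k"
proof -
  have "(scalar_fps s * fps_const x) ^ n = scalar_fps (s ^ n) * fps_const (x ^ n)" for n
  proof (induction n)
    case (Suc n)
    have "(scalar_fps s * fps_const x) ^ Suc n = scalar_fps s * (fps_const x * scalar_fps (s ^ n)) * fps_const (x ^ n)"
      by (simp add: Suc mult.assoc)
    also have "\<dots> = (scalar_fps s * scalar_fps (s ^ n)) * (fps_const x * fps_const (x ^ n))"
      by (simp only: scalar_fps_commute[of "fps_const x"] mult.assoc)
    finally show ?case by (simp flip: scalar_fps_mult)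
  qed simp
  then show ?thesis
    using assms by (simp add: geometric_fps_nth_upto[of s k N] fps_sum_nth)
qed

lemma geometric_fps_unfold:
  assumes "s $ 0 = 0"
  shows "geometric_fps s x = 1 + scalar_fps s * fps_const x * geometric_fps s x" (is ?A)
    and "geometric_fps s x = 1 + geometric_fps s x * (scalar_fps s * fps_const x)" (is ?B)
proof -
  let ?q = "scalar_fps s * fps_const x"
  have q0: "?q $ 0 = 0" using assms by simp
  have partial: "(\<Sum>n\<le>Suc k. ?q ^ n) = 1 + ?q * (\<Sum>n\<le>k. ?q ^ n)"
                "(\<Sum>n\<le>Suc k. ?q ^ n) = 1 + (\<Sum>n\<le>k. ?q ^ n) * ?q" for k
    by (simp_all add: sum.atMost_Suc_shift sum_distrib_left sum_distrib_right power_commutes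
                 del: sum.atMost_Suc)
  have "geometric_fps s x $ k = (1 + ?q * geometric_fps s x) $ k" "geometric_fps s x $ k = (1 + geometric_fps s x * ?q) $ k" for k
  proof -
    have "geometric_fps s x $ k = (1 + ?q * (\<Sum>n\<le>k. ?q ^ n)) $ k"
      using geometric_fps_eq_partial_sum[OF assms, of k "Suc k" x] by (simp only: partial(1))
    also have "(?q * (\<Sum>n\<le>k. ?q ^ n)) $ k = (?q * geometric_fps s x) $ k"
      unfolding fps_mult_nth
      by (intro sum.cong refl arg_cong2[where f = "(*)"] geometric_fps_eq_partial_sum[symmetric] assms) simp
    ultimately show "geometric_fps s x $ k = (1 + ?q * geometric_fps s x) $ k" by simp
  next
    have "geometric_fps s x $ k = (1 + (\<Sum>n\<le>k. ?q ^ n) * ?q) $ k"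
      using geometric_fps_eq_partial_sum[OF assms, of k "Suc k" x] by (simp only: partial(2))
    also have "((\<Sum>n\<le>k. ?q ^ n) * ?q) $ k = (geometric_fps s x * ?q) $ k"
      unfolding fps_mult_nth
      by (intro sum.cong refl arg_cong2[where f = "(*)"] geometric_fps_eq_partial_sum[symmetric] assms) simp
    ultimately show "geometric_fps s x $ k = (1 + geometric_fps s x * ?q) $ k" by simp
  qed
  then show ?A ?B by (auto intro: fps_ext)
qed

lemma apply_coeffs_geom:
  assumes "nc_distribution \<phi>" "s $ 0 = 0"
  shows "apply_coeffs \<phi> (geometric_fps s x) = Abs_fps (\<lambda>n. \<phi> (x ^ n)) oo s"
  by (rule fps_ext)
     (simp add: geometric_fps_def fps_compose_nth nc_distribution_sum nc_distribution_scale assms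
        mult.commute atLeast0AtMost)

text \<open>Power series all of whose coefficients are polynomials in the variable \<open>i\<close> of expectation zero.\<close>

definition centred_in :: "('i nc_poly \<Rightarrow> complex) \<Rightarrow> 'i \<Rightarrow> 'i nc_poly fps set" where
  "centred_in \<phi> i = {F. \<forall>k. \<exists>p. F $ k = nc_eval p (nc_var i) \<and> \<phi> (F $ k) = 0}"

text \<open>
  The coefficients of a product of series are sums of products of coefficients.  The list \<open>fs\<close>
  collects the coefficients already chosen, so that the induction on \<open>is\<close> moves one factor at a time
  to the left.
\<close>

lemma free_distribution_alternating_aux:
  fixes F :: "'i \<Rightarrow> 'i nc_poly fps"
  assumes "nc_distribution \<phi>" "free_distribution \<phi>"
    and F: "\<And>i. i \<in> set is \<Longrightarrow> F i \<in> centred_in \<phi> i"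
    and fs: "\<forall>(i, p) \<in> set fs. \<phi> (nc_eval p (nc_var i)) = 0"
    and "distinct_adj (map fst fs @ is)" "map fst fs @ is \<noteq> []"
  shows "\<phi> (prod_list (map (\<lambda>(i, p). nc_eval p (nc_var i)) fs) * prod_list (map F is) $ k) = 0"
  using F fs assms(5,6)
proof (induction "is" arbitrary: fs k)
  case Nil
  then have "\<phi> (prod_list (map (\<lambda>(i, p). nc_eval p (nc_var i)) fs)) = 0"
    using assms(2) unfolding free_distribution_def by auto
  then show ?case by (simp add: nc_distribution_0[OF assms(1)])
next
  case (Cons i "is")
  let ?P = "prod_list (map (\<lambda>(i, p). nc_eval p (nc_var i)) fs)"
  have "\<phi> (?P * (F i $ j * prod_list (map F is) $ l)) = 0" for j l
  proof -
    obtain p where p: "F i $ j = nc_eval p (nc_var i)" "\<phi> (nc_eval p (nc_var i)) = 0"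
      using Cons.prems(1)[of i] by (auto simp: centred_in_def) metis
    have "\<phi> (prod_list (map (\<lambda>(i, p). nc_eval p (nc_var i)) (fs @ [(i, p)])) *
             prod_list (map F is) $ l) = 0"
      by (rule Cons.IH) (use Cons.prems p in auto)
    then show ?thesis by (simp add: p mult.assoc)
  qed
  then show ?case
    by (simp add: fps_mult_nth sum_distrib_left nc_distribution_sum[OF assms(1)])
qed

lemma free_distribution_alternating:
  assumes "nc_distribution \<phi>" "free_distribution \<phi>"
    and "\<And>i. i \<in> set is \<Longrightarrow> F i \<in> centred_in \<phi> i" "distinct_adj is" "is \<noteq> []"
  shows "apply_coeffs \<phi> (prod_list (map F is)) = 0"
  by (rule fps_ext)
     (use free_distribution_alternating_aux[OF assms(1,2), of "is" F "[]"] assms(3-) in simp)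


section \<open>Products of free variables\<close>

text \<open>The word \<open>i, j, i, j, \<dots>\<close> of the given length.\<close>

primrec alternate :: "'i \<Rightarrow> 'i \<Rightarrow> nat \<Rightarrow> 'i list" where
  "alternate i j 0 = []"
| "alternate i j (Suc m) = i # alternate j i m"

lemma distinct_adj_alternate: "i \<noteq> j \<Longrightarrow> distinct_adj (alternate i j m)"
proof (induction m arbitrary: i j)
  case (Suc m)
  then show ?case using Suc.IH[of j i] by (cases m) auto
qed simp

lemma prod_list_alternate:
  "prod_list (map F (alternate i j (2 * n))) = (F i * F j) ^ n"
  "prod_list (map F (alternate i j (Suc (2 * n)))) = (F i * F j) ^ n * F i"
  by (induction n) (simp_all add: mult.assoc)

lemma apply_coeffs_alternating:
  assumes "nc_distribution \<phi>" "free_distribution \<phi>" "i \<noteq> j"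
    and F: "A \<in> centred_in \<phi> i" "B \<in> centred_in \<phi> j"
  shows "n > 0 \<Longrightarrow> apply_coeffs \<phi> ((A * B) ^ n) = 0"
    and "apply_coeffs \<phi> ((A * B) ^ n * A) = 0"
    and "apply_coeffs \<phi> (B * (A * B) ^ n) = 0"
    and "apply_coeffs \<phi> (B * (A * B) ^ n * A) = 0"
proof -
  let ?F = "\<lambda>k. if k = i then A else B"
  have alt: "apply_coeffs \<phi> (prod_list (map ?F (alternate k l m))) = 0"
    if "m > 0" "(k, l) = (i, j) \<or> (k, l) = (j, i)" for k l m
  proof (rule free_distribution_alternating[OF assms(1,2)])
    have "set (alternate k l m) \<subseteq> {k, l}" for k l :: 'a and m
      by (induction m arbitrary: k l) auto
    then show "?F x \<in> centred_in \<phi> x" if "x \<in> set (alternate k l m)" for x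
      using F that \<open>(k, l) = (i, j) \<or> (k, l) = (j, i)\<close> by fastforce
    show "distinct_adj (alternate k l m)"
      using that(2) assms(3) by (intro distinct_adj_alternate) auto
    show "alternate k l m \<noteq> []"
      using that(1) by (cases m) auto
  qed
  show "apply_coeffs \<phi> ((A * B) ^ n) = 0" if "n > 0"
    using alt[of "2 * n" i j] that assms(3) prod_list_alternate(1)[of ?F i j n] by simp
  show "apply_coeffs \<phi> ((A * B) ^ n * A) = 0"
    using alt[of "Suc (2 * n)" i j] assms(3) prod_list_alternate(2)[of ?F i j n] by simp
  show "apply_coeffs \<phi> (B * (A * B) ^ n) = 0"
    using alt[of "Suc (2 * n)" j i] assms(3) prod_list_alternate(1)[of ?F i j n] by simp
  show "apply_coeffs \<phi> (B * (A * B) ^ n * A) = 0"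
    using alt[of "Suc (Suc (2 * n))" j i] assms(3) prod_list_alternate(2)[of ?F i j n]
    by (simp add: mult.assoc)
qed

lemma nc_eval_exists: "\<exists>p. (\<Sum>n\<le>N. nc_const (c n) * x ^ n) = nc_eval p x"
proof
  let ?p = "\<Sum>n\<le>N. monom (c n) n"
  have coeff: "coeff ?p k = (if k \<le> N then c k else 0)" for k
    by (simp add: coeff_sum)
  have deg: "Polynomial.degree ?p \<le> N"
    by (rule degree_le) (simp add: coeff)
  show "(\<Sum>n\<le>N. nc_const (c n) * x ^ n) = nc_eval ?p x"
    unfolding nc_eval_def
    by (rule sum.mono_neutral_cong_right)
       (use deg in \<open>auto simp: coeff, metis coeff coeff_eq_0 not_le_imp_less nc_const_0 mult_zero_left\<close>)
qed

text \<open>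
  If \<open>1 / (1 - s x)\<close> has expectation \<open>1 + w\<close>, where \<open>w\<close> is the formal variable and \<open>x\<close> the variable
  \<open>i\<close> of the free algebra, then it is \<open>1 + w + w A\<close> with \<open>A\<close> centred.
\<close>

lemma geometric_fps_centred:
  assumes "nc_distribution \<phi>" "s $ 0 = 0"
    and "Abs_fps (\<lambda>n. \<phi> (nc_var i ^ n)) oo s = 1 + fps_X"
  obtains A where "A \<in> centred_in \<phi> i" "geometric_fps s (nc_var i) = 1 + fps_X + fps_X * A"
proof
  let ?g = "geometric_fps s (nc_var i) - (1 + fps_X)"
  have apply_coeffs_g: "apply_coeffs \<phi> (geometric_fps s (nc_var i)) = 1 + fps_X"
    using assms by (simp add: apply_coeffs_geom)
  have g0: "?g $ 0 = 0"
    by (simp add: geometric_fps_def)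
  show "geometric_fps s (nc_var i) = 1 + fps_X + fps_X * fps_shift 1 ?g"
    by (rule fps_ext) (use g0 in \<open>auto simp: fps_X_mult_nth\<close>)
  show "fps_shift 1 ?g \<in> centred_in \<phi> i"
    unfolding centred_in_def
  proof (intro CollectI allI)
    fix k
    define d :: complex where "d = (1 + fps_X) $ Suc k"
    have d: "(1 + fps_X :: 'a nc_poly fps) $ Suc k = nc_const d"
      by (simp add: d_def)
    have "fps_shift 1 ?g $ k =
        (\<Sum>n\<le>Suc k. nc_const ((s ^ n) $ Suc k) * nc_var i ^ n) - nc_const d"
      by (simp add: geometric_fps_def flip: d)
    also have "\<dots> = (\<Sum>n\<le>Suc k. nc_const ((s ^ n) $ Suc k - (if n = 0 then d else 0)) * nc_var i ^ n)"
      unfolding sum.atMost_Suc_shift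
      by (simp add: algebra_simps nc_const_def flip: single_diff single_add)
    finally obtain p where p: "fps_shift 1 ?g $ k = nc_eval p (nc_var i)"
      using nc_eval_exists[where N = "Suc k"] by metis
    have "\<phi> (geometric_fps s (nc_var i) $ Suc k) = d"
      using arg_cong[OF apply_coeffs_g, of "\<lambda>F. F $ Suc k"] by (simp add: d_def)
    moreover have "\<phi> (geometric_fps s (nc_var i) $ Suc k) = \<phi> (fps_shift 1 ?g $ k + nc_const d * 1)"
      by (simp flip: d)
    ultimately have "\<phi> (fps_shift 1 ?g $ k) = 0"
      by (simp only: nc_distribution_add[OF assms(1)] nc_distribution_scale[OF assms(1)]
            nc_distribution_1[OF assms(1)]) simp
    then show "\<exists>p. fps_shift 1 ?g $ k = nc_eval p (nc_var i) \<and> \<phi> (fps_shift 1 ?g $ k) = 0"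
      using p by blast
  qed
qed

lemma fps_X_mult_cancel:
  fixes F G :: "'a :: semiring_1 fps"
  assumes "fps_X * F = fps_X * G"
  shows "F = G"
proof (rule fps_ext)
  fix n
  show "F $ n = G $ n"
    using arg_cong[OF assms, of "\<lambda>H. H $ Suc n"] by simp
qed

text \<open>
  With \<open>a = W + W A\<close> and \<open>b = W + W B\<close> this is
  \<open>W (1 + a) (1 + b) - (1 + W) a b = W ((1 + W) - W A B)\<close>: all terms linear in \<open>A\<close> and \<open>B\<close> cancel.
\<close>

lemma bracket_identity:
  fixes W A B :: "'a :: ring_1"
  assumes central: "\<And>x. x * W = W * x"
  shows "W * (1 + W + W * A) * (1 + W + W * B) - (1 + W) * (W + W * A) * (W + W * B) =
         W * ((1 + W) - W * (A * B))"
proof -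
  have "A * W = W * A" "B * W = W * B" "A * (W * c) = W * (A * c)" "B * (W * c) = W * (B * c)" for c
    using central by (auto simp flip: mult.assoc)
  then show ?thesis
    by (simp add: algebra_simps)
qed

text \<open>
  Multiplicativity of the S-transform, in terms of the inverses \<open>\<alpha>\<close>, \<open>\<beta>\<close>, \<open>\<zeta>\<close> of the moment
  generating series of \<open>a\<close>, \<open>b\<close> and \<open>a b\<close>; the formal variable plays the role of \<open>w\<close>.
\<close>

lemma free_product_moment_series:
  assumes nd: "nc_distribution \<phi>" and free: "free_distribution \<phi>" and "i \<noteq> j"
    and s0: "\<alpha> $ 0 = 0" "\<beta> $ 0 = 0"
    and a: "Abs_fps (\<lambda>n. \<phi> (nc_var i ^ n)) oo \<alpha> = 1 + fps_X"
    and b: "Abs_fps (\<lambda>n. \<phi> (nc_var j ^ n)) oo \<beta> = 1 + fps_X"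
    and z: "fps_X * \<zeta> = \<alpha> * \<beta> * (1 + fps_X)"
  shows "Abs_fps (\<lambda>n. \<phi> ((nc_var i * nc_var j) ^ n)) oo \<zeta> = 1 + fps_X"
proof -
  obtain A where A: "A \<in> centred_in \<phi> i" "geometric_fps \<alpha> (nc_var i) = 1 + fps_X + fps_X * A"
    using geometric_fps_centred[OF nd s0(1) a] .
  obtain B where B: "B \<in> centred_in \<phi> j" "geometric_fps \<beta> (nc_var j) = 1 + fps_X + fps_X * B"
    using geometric_fps_centred[OF nd s0(2) b] .
  define W :: "'a nc_poly fps" where "W = fps_X"
  define ga where "ga = 1 + W + W * A"
  define gb where "gb = 1 + W + W * B"
  define P where "P = scalar_fps \<alpha> * fps_const (nc_var i)"
  define Q where "Q = scalar_fps \<beta> * fps_const (nc_var j)"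
  define Z where "Z = scalar_fps \<zeta> * fps_const (nc_var i * nc_var j)"
  define s :: "complex fps" where "s = fps_X * inverse (1 + fps_X)"
  have W: "W = scalar_fps fps_X" "1 + W = scalar_fps (1 + fps_X)"
    by (simp_all add: W_def scalar_fps_X scalar_fps_add)
  have central: "x * W = W * x" "x * (1 + W) = (1 + W) * x" for x
    using scalar_fps_commute[of x fps_X] scalar_fps_commute[of x "1 + fps_X"] by (simp_all only: W[symmetric])
  have central_left: "x * (W * y) = W * (x * y)" "x * ((1 + W) * y) = (1 + W) * (x * y)" for x y
    by (simp_all only: central[of x] flip: mult.assoc)
  have "\<zeta> $ 0 = (fps_X * \<zeta>) $ 1" by simp
  also have "\<dots> = 0"
    unfolding z by (simp add: fps_mult_nth s0 sum.atLeast0_atMost_Suc)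
  finally have z0: "\<zeta> $ 0 = 0" .
  have g: "geometric_fps \<alpha> (nc_var i) = ga" "geometric_fps \<beta> (nc_var j) = gb"
    using A B by (simp_all add: ga_def gb_def W_def)
  have pa: "(1 - P) * ga = 1" "ga * (1 - P) = 1"
    using geometric_fps_unfold[OF s0(1), of "nc_var i"] unfolding g
    by (simp_all add: P_def algebra_simps)
  have pb: "(1 - Q) * gb = 1" "gb * (1 - Q) = 1"
    using geometric_fps_unfold[OF s0(2), of "nc_var j"] unfolding g
    by (simp_all add: Q_def algebra_simps)
  have R: "geometric_fps \<zeta> (nc_var i * nc_var j) * (1 - Z) = 1"
    using geometric_fps_unfold(2)[OF z0, of "nc_var i * nc_var j"]
    by (simp add: Z_def algebra_simps)

  \<comment> \<open>Factorisation of \<open>1 - Z\<close>, multiplied by \<open>W\<close> so that \<open>\<zeta>\<close> only occurs in \<open>fps_X * \<zeta>\<close>.\<close>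
  have "scalar_fps (\<alpha> * \<beta> * (1 + fps_X)) = (1 + W) * (scalar_fps \<alpha> * scalar_fps \<beta>)"
    by (simp only: W(2) mult.commute[of "\<alpha> * \<beta>"] flip: scalar_fps_mult)
  moreover have "W * Z = scalar_fps (fps_X * \<zeta>) * (fps_const (nc_var i) * fps_const (nc_var j))"
    by (simp add: W(1) Z_def scalar_fps_mult mult.assoc)
  ultimately have "W * Z = (1 + W) * (scalar_fps \<alpha> * scalar_fps \<beta> * (fps_const (nc_var i) * fps_const (nc_var j)))"
    by (simp only: z mult.assoc)
  also have "scalar_fps \<alpha> * scalar_fps \<beta> * (fps_const (nc_var i) * fps_const (nc_var j)) = P * Q"
    by (simp only: P_def Q_def mult.assoc scalar_fps_left_commute[of "fps_const (nc_var i)"])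
  also have "P * Q = ((1 - P) * (ga - 1)) * ((gb - 1) * (1 - Q))"
  proof -
    have "P = (1 - P) * (ga - 1)" "Q = (gb - 1) * (1 - Q)"
      using pa pb by (simp_all add: algebra_simps)
    then show ?thesis by (rule arg_cong2)
  qed
  also have "(1 + W) * ((1 - P) * (ga - 1) * ((gb - 1) * (1 - Q))) =
      (1 - P) * ((1 + W) * (ga - 1) * (gb - 1)) * (1 - Q)"
    by (simp only: mult.assoc central_left[of "1 - P"])
  finally have WZ: "W * Z = (1 - P) * ((1 + W) * (ga - 1) * (gb - 1)) * (1 - Q)" .
  have "W = W * (((1 - P) * ga) * (gb * (1 - Q)))"
    by (simp add: pa pb)
  also have "\<dots> = (1 - P) * (W * ga * gb) * (1 - Q)"
    by (simp only: mult.assoc central_left[of "1 - P"])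
  finally have "W * (1 - Z) = (1 - P) * (W * ga * gb) * (1 - Q) - W * Z"
    by (simp add: right_diff_distrib)
  also have "\<dots> = (1 - P) * (W * ga * gb - (1 + W) * (ga - 1) * (gb - 1)) * (1 - Q)"
    unfolding WZ by (simp only: right_diff_distrib[of "1 - P"] left_diff_distrib[of _ _ "1 - Q"])
  also have "W * ga * gb - (1 + W) * (ga - 1) * (gb - 1) = W * ((1 + W) - W * (A * B))"
    using bracket_identity[OF central(1), of A B] by (simp add: ga_def gb_def)
  also have "(1 - P) * (W * ((1 + W) - W * (A * B))) * (1 - Q) =
      W * ((1 - P) * ((1 + W) - W * (A * B)) * (1 - Q))"
    by (simp only: mult.assoc central_left[of "1 - P"])
  finally have Z_fact: "1 - Z = (1 - P) * ((1 + W) - W * (A * B)) * (1 - Q)"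
    unfolding W_def by (rule fps_X_mult_cancel)

  \<comment> \<open>\<open>1 + W - W A B = (1 + W) (1 - s A B)\<close>, and \<open>V\<close> inverts the second factor.\<close>
  define V where "V = fps_right_inverse (1 - scalar_fps s * (A * B)) 1"
  have inv: "(1 + fps_X :: complex fps) * inverse (1 + fps_X) = 1"
    by (rule inverse_mult_eq_1') simp
  have "(1 + fps_X) * s = fps_X * ((1 + fps_X) * inverse (1 + fps_X))"
    by (simp only: s_def mult.left_commute)
  then have s: "(1 + W) * scalar_fps s = W"
    by (simp only: W(2) scalar_fps_mult[symmetric] inv mult_1_right) (simp add: W(1))
  have WI: "(1 + W) * scalar_fps (inverse (1 + fps_X)) = 1"
    by (simp only: W(2) scalar_fps_mult[symmetric] inv scalar_fps_1)
  have s_0: "s $ 0 = 0"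
    by (simp add: s_def)
  have V: "(1 - scalar_fps s * (A * B)) * V = 1"
    unfolding V_def by (rule fps_right_inverse) (simp add: s_0)
  have "(1 - Z) * (gb * V * scalar_fps (inverse (1 + fps_X)) * ga) = 1"
  proof -
    have "(1 + W) - W * (A * B) = (1 + W) * (1 - scalar_fps s * (A * B))"
      by (simp add: right_diff_distrib s flip: mult.assoc)
    then have "(1 - Z) * (gb * V * scalar_fps (inverse (1 + fps_X)) * ga) =
        (1 - P) * (1 + W) * ((1 - scalar_fps s * (A * B)) * (((1 - Q) * gb) * V)) * scalar_fps (inverse (1 + fps_X)) * ga"
      unfolding Z_fact by (simp only: mult.assoc)
    also have "\<dots> = (1 - P) * ((1 + W) * scalar_fps (inverse (1 + fps_X))) * ga"
      by (simp add: pb V mult.assoc)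
    also have "\<dots> = 1"
      by (simp add: WI pa)
    finally show ?thesis .
  qed
  then have "geometric_fps \<zeta> (nc_var i * nc_var j) = (geometric_fps \<zeta> (nc_var i * nc_var j) * (1 - Z)) *
      (gb * V * scalar_fps (inverse (1 + fps_X)) * ga)"
    by (simp only: mult.assoc mult_1_right)
  then have "geometric_fps \<zeta> (nc_var i * nc_var j) = gb * V * scalar_fps (inverse (1 + fps_X)) * ga"
    unfolding R by (simp only: mult_1_left)
  also have "\<dots> = scalar_fps (inverse (1 + fps_X)) * (gb * V * ga)"
    by (simp only: mult.assoc scalar_fps_left_commute[of V] scalar_fps_left_commute[of gb])
  finally have apply_coeffs_R: "apply_coeffs \<phi> (geometric_fps \<zeta> (nc_var i * nc_var j)) =
      inverse (1 + fps_X) * apply_coeffs \<phi> (gb * V * ga)"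
    by (simp add: apply_coeffs_scale[OF nd])

  \<comment> \<open>\<open>s\<close> has no constant term, so the remainder does not contribute to coefficients below \<open>N\<close>.\<close>
  have V_partial: "V = (\<Sum>n<N. scalar_fps (s ^ n) * (A * B) ^ n) + scalar_fps (s ^ N) * (A * B) ^ N * V" for N
  proof (induction N)
    case (Suc N)
    have "V = 1 + scalar_fps s * (A * B) * V"
      using V by (simp add: algebra_simps)
    then have "scalar_fps (s ^ N) * (A * B) ^ N * V =
        scalar_fps (s ^ N) * (A * B) ^ N + scalar_fps (s ^ N) * ((A * B) ^ N * scalar_fps s) * (A * B) * V"
      by (metis (no_types, lifting) distrib_left mult.assoc mult.right_neutral)
    also have "\<dots> = scalar_fps (s ^ N) * (A * B) ^ N + scalar_fps (s ^ Suc N) * (A * B) ^ Suc N * V"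
      by (simp only: scalar_fps_commute[of "(A * B) ^ N"] power_Suc2 scalar_fps_mult mult.assoc)
    finally show ?case using Suc by (simp add: add.assoc)
  qed simp
  have one_X: "1 + W + W * C = scalar_fps (1 + fps_X) + scalar_fps fps_X * C" for C
    by (simp add: W(1) scalar_fps_add)
  \<comment> \<open>By freeness only the scalar part of the term \<open>n = 0\<close> survives.\<close>
  have term_n: "apply_coeffs \<phi> (gb * (scalar_fps (s ^ n) * (A * B) ^ n) * ga) = (if n = 0 then (1 + fps_X) ^ 2 else 0)" for n
  proof -
    have "gb * (scalar_fps (s ^ n) * (A * B) ^ n) * ga =
        scalar_fps (s ^ n) * (scalar_fps (1 + fps_X) * (scalar_fps (1 + fps_X) * (A * B) ^ n) +
          scalar_fps (1 + fps_X) * (scalar_fps fps_X * ((A * B) ^ n * A)) +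
          scalar_fps fps_X * (scalar_fps (1 + fps_X) * (B * (A * B) ^ n)) +
          scalar_fps fps_X * (scalar_fps fps_X * (B * (A * B) ^ n * A)))"
    proof -
      have "gb * (scalar_fps (s ^ n) * (A * B) ^ n) * ga = scalar_fps (s ^ n) * (gb * (A * B) ^ n * ga)"
        by (simp only: mult.assoc scalar_fps_left_commute[of gb])
      moreover have "gb * T * ga = scalar_fps (1 + fps_X) * (scalar_fps (1 + fps_X) * T) +
          scalar_fps (1 + fps_X) * (scalar_fps fps_X * (T * A)) +
          scalar_fps fps_X * (scalar_fps (1 + fps_X) * (B * T)) +
          scalar_fps fps_X * (scalar_fps fps_X * (B * T * A))" for T
      proof -
        have "T * scalar_fps (1 + fps_X) = scalar_fps (1 + fps_X) * T" "B * scalar_fps (1 + fps_X) = scalar_fps (1 + fps_X) * B"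
           "T * (scalar_fps fps_X * y) = scalar_fps fps_X * (T * y)" "B * (scalar_fps fps_X * y) = scalar_fps fps_X * (B * y)"
           "T * (scalar_fps (1 + fps_X) * y) = scalar_fps (1 + fps_X) * (T * y)"
           "B * (scalar_fps (1 + fps_X) * y) = scalar_fps (1 + fps_X) * (B * y)"
           "scalar_fps fps_X * (scalar_fps (1 + fps_X) * y) = scalar_fps (1 + fps_X) * (scalar_fps fps_X * y)" for y
          by (rule scalar_fps_commute scalar_fps_left_commute)+
        then show ?thesis
          unfolding ga_def gb_def one_X
          by (simp only: distrib_left distrib_right mult.assoc add.assoc) (simp add: ac_simps)
      qed
      ultimately show ?thesis by simp
    qed
    then show ?thesis
      using apply_coeffs_alternating[OF nd free \<open>i \<noteq> j\<close> A(1) B(1), of n]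
      by (simp add: apply_coeffs_scale[OF nd] apply_coeffs_add[OF nd] apply_coeffs_1[OF nd] power2_eq_square)
  qed
  have "apply_coeffs \<phi> (gb * V * ga) = (1 + fps_X) ^ 2"
  proof (rule fps_ext)
    fix k
    have "gb * V * ga = (\<Sum>n<Suc k. gb * (scalar_fps (s ^ n) * (A * B) ^ n) * ga) +
        gb * scalar_fps (s ^ Suc k) * ((A * B) ^ Suc k * V * ga)"
      by (subst V_partial[of "Suc k"])
         (simp only: distrib_left distrib_right sum_distrib_left sum_distrib_right mult.assoc)
    also have "gb * scalar_fps (s ^ Suc k) * ((A * B) ^ Suc k * V * ga) =
        scalar_fps (s ^ Suc k) * (gb * ((A * B) ^ Suc k * V * ga))"
      by (simp only: scalar_fps_commute[of gb] mult.assoc)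
    finally have "apply_coeffs \<phi> (gb * V * ga) = (\<Sum>n<Suc k. apply_coeffs \<phi> (gb * (scalar_fps (s ^ n) * (A * B) ^ n) * ga)) +
        s ^ Suc k * apply_coeffs \<phi> (gb * ((A * B) ^ Suc k * V * ga))"
      by (simp only: apply_coeffs_add[OF nd] apply_coeffs_sum[OF nd] apply_coeffs_scale[OF nd])
    also have "(\<Sum>n<Suc k. apply_coeffs \<phi> (gb * (scalar_fps (s ^ n) * (A * B) ^ n) * ga)) = (1 + fps_X) ^ 2"
      unfolding term_n by (simp add: sum.delta)
    finally show "apply_coeffs \<phi> (gb * V * ga) $ k = ((1 + fps_X) ^ 2) $ k"
      by (simp add: fps_mult_nth startsby_zero_power_prefix s_0 del: power_Suc apply_coeffs_nth)
  qed
  with apply_coeffs_R have "apply_coeffs \<phi> (geometric_fps \<zeta> (nc_var i * nc_var j)) = inverse (1 + fps_X) * (1 + fps_X) ^ 2"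
    by simp
  also have "\<dots> = 1 + fps_X"
    using inv by (simp add: power2_eq_square mult.assoc[symmetric] mult.commute)
  finally show ?thesis
    by (simp add: apply_coeffs_geom[OF nd z0])
qed

section \<open>Moment series of the Raney distributions and their convolution\<close>

text \<open>The moment generating series, with complex coefficients.\<close>

definition moment_series :: "real measure \<Rightarrow> complex fps" where
  "moment_series \<mu> = Abs_fps (\<lambda>n. of_real (moment \<mu> n))"

lemma moment_series_nth [simp]: "moment_series \<mu> $ n = of_real (moment \<mu> n)"
  by (simp add: moment_series_def)

lemma moment_series_free_mult_conv:
  assumes "is_free_mult_conv \<mu> \<nu> \<rho>" "\<alpha> $ 0 = 0" "\<beta> $ 0 = 0"
    and "moment_series \<mu> oo \<alpha> = 1 + fps_X" "moment_series \<nu> oo \<beta> = 1 + fps_X"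
    and "fps_X * \<zeta> = \<alpha> * \<beta> * (1 + fps_X)"
  shows "moment_series \<rho> oo \<zeta> = 1 + fps_X"
proof -
  from assms(1) obtain \<phi> :: "bool nc_poly \<Rightarrow> complex" where \<phi>:
    "nc_distribution \<phi>" "free_distribution \<phi>"
    "\<And>n. \<phi> (nc_var False ^ n) = of_real (moment \<mu> n)"
    "\<And>n. \<phi> (nc_var True ^ n) = of_real (moment \<nu> n)"
    "\<And>n. \<phi> ((nc_var False * nc_var True) ^ n) = of_real (moment \<rho> n)"
    unfolding is_free_mult_conv_def by blast
  show ?thesis
    using free_product_moment_series[OF \<phi>(1,2), of False True \<alpha> \<beta> \<zeta>] assms(2-)
    by (simp add: \<phi>(3-5) moment_series_def)
qed

lemma one_plus_X_inverse: "(1 + fps_X :: complex fps) * inverse (1 + fps_X) = 1"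
  by (rule inverse_mult_eq_1') simp

lemma moment_series_raney_1_half:
  assumes "is_raney 1 (1/2) A"
  shows "moment_series A oo (fps_X * (2 + fps_X) * inverse (1 + fps_X) ^ 2) = 1 + fps_X"
proof -
  define S :: "complex fps" where "S = fps_binomial (-1/2) oo - fps_X"
  have moment: "moment A k = (-1) ^ k * ((-1/2) gchoose k)" for k
  proof -
    have "(1/2) * ((real k + 1/2) gchoose k) = (real k + 1/2) * ((real k + 1/2 - 1) gchoose k)"
      using gbinomial_absorb_comp[of "real k + 1/2" k] by simp
    moreover have "moment A k = (1/2) * ((real k + 1/2) gchoose k) / (real k + 1/2)"
      using assms by (simp add: is_raney_def)
    ultimately have "moment A k = (real k + 1/2) * ((real k + 1/2 - 1) gchoose k) / (real k + 1/2)"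
      by (simp only:)
    also have "\<dots> = (real k + 1/2 - 1) gchoose k"
      by (rule nonzero_mult_div_cancel_left) linarith
    finally have "moment A k = (real k - 1/2) gchoose k"
      by simp
    then show ?thesis
      using gbinomial_negated_upper[of "real k - 1/2" k] by simp
  qed
  have "moment_series A = S"
  proof (rule fps_ext)
    fix k
    have "complex_of_real ((-1/2) gchoose k) = (-1/2) gchoose k"
      by (simp add: gbinomial_prod_rev)
    then show "moment_series A $ k = S $ k"
      by (simp add: S_def fps_compose_uminus' moment)
  qed
  have S: "S ^ 2 * (1 - fps_X) = 1"
  proof -
    have "S ^ 2 = inverse (1 + fps_X) oo - fps_X"
      by (simp add: S_def fps_compose_power fps_binomial_power fps_binomial_minus_one)
    moreover have "1 - fps_X = (1 + fps_X :: complex fps) oo - fps_X"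
      by (simp add: fps_compose_add_distrib)
    ultimately have "S ^ 2 * (1 - fps_X) = (inverse (1 + fps_X) * (1 + fps_X)) oo - fps_X"
      by (simp add: fps_compose_mult_distrib)
    then show ?thesis
      using one_plus_X_inverse by (simp add: mult.commute)
  qed
  define \<chi> :: "complex fps" where "\<chi> = fps_X * (2 + fps_X) * inverse (1 + fps_X) ^ 2"
  have \<chi>0: "\<chi> $ 0 = 0"
    by (simp add: \<chi>_def)
  have "(S oo \<chi>) ^ 2 * (1 - \<chi>) = (S ^ 2 * (1 - fps_X)) oo \<chi>"
    by (simp add: fps_compose_mult_distrib fps_compose_power fps_compose_sub_distrib \<chi>0)
  also have "\<dots> = 1"
    using S by simp
  finally have 1: "(S oo \<chi>) ^ 2 * (1 - \<chi>) = 1" .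
  have "\<chi> * (1 + fps_X) ^ 2 = fps_X * (2 + fps_X) * ((1 + fps_X) * inverse (1 + fps_X)) ^ 2"
    by (simp add: \<chi>_def power_mult_distrib)
  also have "\<dots> = fps_X * (2 + fps_X)"
    by (simp only: one_plus_X_inverse power_one mult_1_right)
  finally have "(1 - \<chi>) * (1 + fps_X) ^ 2 = (1 + fps_X) ^ 2 - fps_X * (2 + fps_X)"
    by (simp only: left_diff_distrib mult_1_left)
  also have "\<dots> = 1"
    by (simp add: power2_eq_square algebra_simps)
  finally have 2: "(1 - \<chi>) * (1 + fps_X) ^ 2 = 1" .
  have "(S oo \<chi>) ^ 2 = (S oo \<chi>) ^ 2 * ((1 - \<chi>) * (1 + fps_X) ^ 2)"
    by (simp only: 2 mult_1_right)
  also have "\<dots> = (1 + fps_X) ^ 2"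
    by (simp only: mult.assoc[symmetric] 1 mult_1_left)
  finally have "(S oo \<chi>) ^ 2 = (1 + fps_X) ^ 2" .
  then have "S oo \<chi> = 1 + fps_X \<or> S oo \<chi> = - (1 + fps_X)"
    by (simp only: power2_eq_iff)
  moreover have "(S oo \<chi>) $ 0 \<noteq> (- (1 + fps_X)) $ 0"
    by (simp add: S_def)
  ultimately have "S oo \<chi> = 1 + fps_X"
    by metis
  then show ?thesis
    using \<open>moment_series A = S\<close> by (simp add: \<chi>_def)
qed

text \<open>The Catalan numbers are the coefficients of \<open>(1 - sqrt (1 - 4 x)) / (2 x)\<close>.\<close>

lemma moment_raney_2_1:
  assumes "is_raney 2 1 P"
  shows "2 * moment P k = - ((1/2) gchoose Suc k) * (-4) ^ Suc k"
proof (induction k)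
  case 0
  then show ?case using assms by (simp add: is_raney_def)
next
  case (Suc k)
  have m: "moment P n = fact (2 * n) / (fact n * fact (Suc n))" for n
  proof -
    have "real n * 2 + 1 = real (2 * n + 1)"
      by simp
    then have "(real n * 2 + 1) gchoose n = real ((2 * n + 1) choose n)"
      by (simp only: binomial_gbinomial)
    also have "\<dots> = fact (2 * n + 1) / (fact n * fact (Suc n))"
    proof -
      have "n \<le> 2 * n + 1" "2 * n + 1 - n = Suc n" by simp_all
      then show ?thesis by (simp only: binomial_fact)
    qed
    also have "\<dots> = (real n * 2 + 1) * (fact (2 * n) / (fact n * fact (Suc n)))"
    proof -
      have "fact (2 * n + 1) = (real n * 2 + 1) * fact (2 * n)" by simp
      then show ?thesis by (simp only: times_divide_eq_right)
    qed
    finally have "moment P n = 1 / (real n * 2 + 1) *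
        ((real n * 2 + 1) * (fact (2 * n) / (fact n * fact (Suc n))))"
      using assms by (simp add: is_raney_def)
    also have "\<dots> = fact (2 * n) / (fact n * fact (Suc n))"
    proof -
      have "1 / c * (c * x) = x" if "c \<noteq> 0" for c x :: real
        using that by simp
      moreover have "real n * 2 + 1 \<noteq> 0" by linarith
      ultimately show ?thesis by blast
    qed
    finally show ?thesis .
  qed
  have "real (k + 2) * moment P (Suc k) = 2 * (2 * real k + 1) * moment P k"
  proof -
    have "b * (c * (d * f) / ((a * g) * (b * h))) = 2 * d * (f / (g * h))"
      if "c = 2 * a" "a \<noteq> 0" "b \<noteq> 0" "g \<noteq> 0" "h \<noteq> 0" for a b c d f g h :: real
      using that by (simp add: divide_simps)
    moreover have "fact (2 * Suc k) = (2 * (real k + 1)) * ((2 * real k + 1) * fact (2 * k))"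
      "fact (Suc (Suc k)) = real (k + 2) * fact (Suc k)" "fact (Suc k) = (real k + 1) * fact k"
      by (simp_all add: algebra_simps)
    moreover have "real (k + 2) \<noteq> 0" "real k + 1 \<noteq> 0" "(fact k :: real) \<noteq> 0" "(fact (Suc k) :: real) \<noteq> 0"
      by (simp_all del: fact_Suc)
    ultimately show ?thesis
      unfolding m by metis
  qed
  then have "real (k + 2) * (2 * moment P (Suc k)) =
      2 * (2 * real k + 1) * (- ((1/2) gchoose Suc k) * (-4) ^ Suc k)"
    by (simp only: flip: Suc.IH)
  also have "\<dots> = real (k + 2) * (- ((1/2) gchoose Suc (Suc k)) * (-4) ^ Suc (Suc k))"
  proof -
    have "real (k + 2) * ((1/2) gchoose Suc (Suc k)) = (1/2 - real (Suc k)) * ((1/2) gchoose Suc k)"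
      using gbinomial_mult_1[of "1/2 :: real" "Suc k"] by (simp add: algebra_simps)
    then have "real (k + 2) * (- ((1/2) gchoose Suc (Suc k)) * (-4) ^ Suc (Suc k)) =
        - ((1/2 - real (Suc k)) * ((1/2) gchoose Suc k)) * (-4) ^ Suc (Suc k)"
      by (simp only: mult_minus_left mult_minus_right flip: mult.assoc)
    then show ?thesis by (simp add: algebra_simps)
  qed
  finally have eq: "real (k + 2) * (2 * moment P (Suc k)) = \<dots>" .
  have "real (k + 2) \<noteq> 0" by simp
  from mult_left_cancel[THEN iffD1, OF this eq] show ?case .
qed

lemma moment_series_raney_2_1:
  assumes "is_raney 2 1 P"
  shows "moment_series P oo (fps_X * inverse (1 + fps_X) ^ 2) = 1 + fps_X"
proof -
  define C where "C = moment_series P"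
  define S :: "complex fps" where "S = fps_binomial (1/2) oo (fps_const (-4) * fps_X)"
  have "2 * fps_X * C = 1 - S"
  proof (rule fps_ext)
    fix n
    show "(2 * fps_X * C) $ n = (1 - S) $ n"
    proof (cases n)
      case (Suc k)
      have "complex_of_real ((1/2) gchoose n) = (1/2) gchoose n"
        by (simp add: gbinomial_prod_rev)
      then have "complex_of_real (2 * moment P k) = - ((1/2) gchoose n) * (-4) ^ n"
        unfolding moment_raney_2_1[OF assms] Suc by simp
      then show ?thesis
        by (simp add: Suc C_def S_def fps_compose_linear mult.assoc numeral_fps_const)
    qed (simp add: S_def mult.assoc numeral_fps_const)
  qed
  moreover have "S ^ 2 = 1 - 4 * fps_X"
    by (simp add: S_def fps_compose_power fps_binomial_power fps_binomial_1 fps_compose_add_distrib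
          numeral_fps_const flip: fps_const_neg)
  ultimately have "(1 - 2 * fps_X * C) ^ 2 = 1 - 4 * fps_X"
    by simp
  then have "(4 * fps_X) * (fps_X * C ^ 2 - C + 1) = 0"
    by (simp add: power2_eq_square algebra_simps)
  then have C: "fps_X * C ^ 2 - C + 1 = 0"
    by simp
  define \<chi> :: "complex fps" where "\<chi> = fps_X * inverse (1 + fps_X) ^ 2"
  define D where "D = C oo \<chi>"
  have \<chi>0: "\<chi> $ 0 = 0"
    by (simp add: \<chi>_def)
  have "\<chi> * D ^ 2 - D + 1 = (fps_X * C ^ 2 - C + 1) oo \<chi>"
    by (simp add: D_def fps_compose_mult_distrib fps_compose_power fps_compose_sub_distrib
          fps_compose_add_distrib \<chi>0)
  then have D: "\<chi> * D ^ 2 - D + 1 = 0"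
    by (simp add: C)
  have "\<chi> * (1 + fps_X) ^ 2 = fps_X * ((1 + fps_X) * inverse (1 + fps_X)) ^ 2"
    by (simp add: \<chi>_def power_mult_distrib)
  then have "\<chi> * (1 + fps_X) ^ 2 - (1 + fps_X) + 1 = 0"
    by (simp only: one_plus_X_inverse power_one mult_1_right) simp
  \<comment> \<open>The other root of the quadratic equation is not a power series.\<close>
  with D have "(D - (1 + fps_X)) * (\<chi> * (D + (1 + fps_X)) - 1) = 0"
    by (simp add: power2_eq_square algebra_simps)
  moreover have "(\<chi> * (D + (1 + fps_X)) - 1) $ 0 \<noteq> 0"
    by (simp add: \<chi>0)
  then have "\<chi> * (D + (1 + fps_X)) - 1 \<noteq> 0"
    by (metis fps_zero_nth)
  ultimately have "D = 1 + fps_X"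
    by simp
  then show ?thesis
    by (simp add: D_def C_def \<chi>_def)
qed

lemma moment_series_power_raney_1_half:
  assumes "is_free_mult_power A n N" "is_raney 1 (1/2) A"
  shows "moment_series N oo (fps_X * (2 + fps_X) ^ n * inverse (1 + fps_X) ^ (n + 1)) = 1 + fps_X"
  using assms(1)
proof (induction rule: is_free_mult_power.induct)
  case one
  show ?case
    using moment_series_raney_1_half[OF assms(2)] by (simp add: power2_eq_square)
next
  case (Suc n \<nu> \<rho>)
  have "(1 + fps_X :: complex fps) * inverse (1 + fps_X) ^ (n + 3) = inverse (1 + fps_X) ^ (n + 2)"
    using one_plus_X_inverse by (simp add: numeral_3_eq_3 flip: mult.assoc)
  then have "fps_X * (fps_X * (2 + fps_X :: complex fps) ^ Suc n * inverse (1 + fps_X) ^ (Suc n + 1)) =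
      fps_X * (2 + fps_X) * inverse (1 + fps_X) ^ 2 *
      (fps_X * (2 + fps_X) ^ n * inverse (1 + fps_X) ^ (n + 1)) * (1 + fps_X)"
    by (simp add: numeral_3_eq_3 power2_eq_square mult_ac)
  from moment_series_free_mult_conv[OF Suc.hyps(2) _ _ moment_series_raney_1_half[OF assms(2)] Suc.IH this]
  show ?case by simp
qed

section \<open>Lagrange inversion\<close>

text \<open>
  Lagrange inversion in the form: \<open>M\<^sub>k\<close> is the residue of \<open>H \<chi>' / \<chi>^(k + 1)\<close>, where \<open>\<chi> = fps_X * h\<close>
  and \<open>H = M \<circ> \<chi>\<close>.
\<close>

lemma lagrange_inversion:
  fixes M h H :: "complex fps"
  assumes h0: "h $ 0 \<noteq> 0" and H: "M oo (fps_X * h) = H"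
  shows "(H * fps_deriv (fps_X * h) * inverse h ^ Suc k) $ k = M $ k"
proof -
  define \<chi> where "\<chi> = fps_X * h"
  define G where "G = inverse h"
  have hG: "h * G = 1"
    unfolding G_def by (rule inverse_mult_eq_1'[OF h0])
  have \<chi>0: "\<chi> $ 0 = 0"
    by (simp add: \<chi>_def)
  have \<chi>': "fps_deriv \<chi> = h + fps_X * fps_deriv h"
    by (simp add: \<chi>_def)
  have dG: "fps_deriv G = - fps_deriv h * G ^ 2"
    unfolding G_def by (rule fps_inverse_deriv[OF h0])
  have hG_pow: "h ^ n * G ^ n = 1" for n
    using hG by (simp flip: power_mult_distrib)
  have "M = (\<Sum>n\<le>k. fps_const (M $ n) * fps_X ^ n) + fps_X ^ Suc k * fps_shift (Suc k) M"
  proof (rule fps_ext)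
    fix m
    show "M $ m = ((\<Sum>n\<le>k. fps_const (M $ n) * fps_X ^ n) + fps_X ^ Suc k * fps_shift (Suc k) M) $ m"
      by (simp add: fps_sum_nth fps_X_power_mult_nth if_distrib[of "(*) _"] sum.delta'
               del: power_Suc cong: if_cong)
  qed
  then have "H = ((\<Sum>n\<le>k. fps_const (M $ n) * fps_X ^ n) + fps_X ^ Suc k * fps_shift (Suc k) M) oo \<chi>"
    using H \<chi>_def by simp
  also have "\<dots> = (\<Sum>n\<le>k. fps_const (M $ n) * \<chi> ^ n) + \<chi> ^ Suc k * (fps_shift (Suc k) M oo \<chi>)"
    by (simp add: fps_compose_add_distrib fps_compose_sum_distrib fps_compose_mult_distrib \<chi>0
          del: power_Suc flip: fps_compose_power)
  finally have "H * fps_deriv \<chi> * G ^ Suc k =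
      (\<Sum>n\<le>k. fps_const (M $ n) * (\<chi> ^ n * fps_deriv \<chi> * G ^ Suc k)) +
      \<chi> ^ Suc k * G ^ Suc k * ((fps_shift (Suc k) M oo \<chi>) * fps_deriv \<chi>)"
    by (simp only: distrib_right sum_distrib_right mult.assoc) (simp only: mult_ac)
  also have "\<chi> ^ Suc k * G ^ Suc k = fps_X ^ Suc k"
    by (simp only: \<chi>_def power_mult_distrib mult.assoc hG_pow mult_1_right)
  finally have "(H * fps_deriv \<chi> * G ^ Suc k) $ k =
      (\<Sum>n\<le>k. M $ n * (\<chi> ^ n * fps_deriv \<chi> * G ^ Suc k) $ k)"
    by (simp add: fps_sum_nth fps_X_power_mult_nth del: power_Suc)
  also have "(\<chi> ^ n * fps_deriv \<chi> * G ^ Suc k) $ k = (if n = k then 1 else 0)" if "n \<le> k" for n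
  proof -
    define j where "j = k - n"
    have G_split: "G ^ Suc k = G ^ n * G ^ Suc j"
      using that by (simp add: j_def flip: power_add)
    have "\<chi> ^ n * fps_deriv \<chi> * G ^ Suc k =
        fps_X ^ n * (h ^ n * G ^ n) * (h + fps_X * fps_deriv h) * G ^ Suc j"
      by (simp only: \<chi>' G_split) (simp only: \<chi>_def power_mult_distrib mult_ac)
    also have "\<dots> = fps_X ^ n * (h * G * G ^ j + fps_X * (fps_deriv h * G ^ Suc j))"
      by (simp only: hG_pow mult_1_right) (simp add: algebra_simps)
    finally have "(\<chi> ^ n * fps_deriv \<chi> * G ^ Suc k) $ k =
        (G ^ j) $ j + (fps_X * (fps_deriv h * G ^ Suc j)) $ j"
      using that by (simp add: fps_X_power_mult_nth hG j_def)
    also have "\<dots> = (if n = k then 1 else 0)"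
    proof (cases j)
      case 0
      then show ?thesis using that by (simp add: j_def)
    next
      case (Suc i)
      \<comment> \<open>The two terms cancel since \<open>(G ^ j)' = - j h' G ^ (j + 1)\<close>.\<close>
      have "fps_deriv (G ^ j) = fps_const (of_nat j) * fps_deriv G * G ^ i"
        using fps_deriv_power[of G j] by (simp only: Suc diff_Suc_1)
      also have "\<dots> = fps_const (- of_nat j) * (fps_deriv h * G ^ Suc j)"
        by (simp add: dG Suc power2_eq_square mult_ac del: of_nat_Suc flip: fps_const_neg)
      finally have "fps_deriv (G ^ j) $ i = - of_nat j * (fps_deriv h * G ^ Suc j) $ i"
        by (simp only: fps_mult_left_const_nth)
      then have "of_nat j * ((G ^ j) $ j + (fps_deriv h * G ^ Suc j) $ i) = 0"
      proof -
        have "fps_deriv (G ^ j) $ i = of_nat j * (G ^ j) $ j"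
          by (simp only: fps_deriv_nth Suc Suc_eq_plus1)
        with \<open>fps_deriv (G ^ j) $ i = - of_nat j * (fps_deriv h * G ^ Suc j) $ i\<close>
        show ?thesis by (simp only: distrib_left mult_minus_left) simp
      qed
      then show ?thesis
        using Suc that by (auto simp: j_def simp del: of_nat_Suc)
    qed
    finally show ?thesis .
  qed
  then have "(\<Sum>n\<le>k. M $ n * (\<chi> ^ n * fps_deriv \<chi> * G ^ Suc k) $ k) = M $ k"
    by (simp add: if_distrib[of "(*) _"] sum.delta' del: power_Suc cong: if_cong)
  finally show ?thesis by (simp add: \<chi>_def G_def)
qed

section \<open>Compactly supported laws are determined by their moments\<close>

text \<open>The characteristic function is the sum of the exponential moment series.\<close>

lemma char_compact_law:
  assumes "compact_law M"
  shows "(\<lambda>n. \<Sum>k\<le>n. (\<i> * complex_of_real t) ^ k / fact k * complex_of_real (moment M k)) \<longlonglongrightarrow> char M t"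
proof -
  from assms interpret real_distribution M
    by (simp add: compact_law_def real_distribution_def real_distribution_axioms_def)
  from assms obtain b where b: "AE x in M. 0 \<le> x \<and> x \<le> b"
    by (auto simp: compact_law_def)
  have bound: "AE x in M. \<bar>x ^ k\<bar> \<le> \<bar>b\<bar> ^ k" for k
    using b by eventually_elim (auto simp: power_abs intro!: power_mono)
  have integrable: "integrable M (\<lambda>x. x ^ k)" for k
    by (rule integrable_const_bound[of _ "\<bar>b\<bar> ^ k"]) (use bound in auto)
  have bound: "norm (char M t - (\<Sum>k\<le>n. (\<i> * complex_of_real t) ^ k / fact k * complex_of_real (moment M k)))
      \<le> 2 * ((\<bar>t\<bar> * \<bar>b\<bar>) ^ n / fact n)" for n
  proof -
    have "expectation (\<lambda>x. \<bar>x\<bar> ^ n) \<le> expectation (\<lambda>x. \<bar>b\<bar> ^ n)"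
      by (rule integral_mono_AE)
         (use integrable[of n, THEN integrable_norm] bound[of n] in \<open>auto simp: power_abs\<close>)
    then have "expectation (\<lambda>x. \<bar>x\<bar> ^ n) \<le> \<bar>b\<bar> ^ n"
      using prob_space by simp
    then have "(2 * \<bar>t\<bar> ^ n / fact n) * expectation (\<lambda>x. \<bar>x\<bar> ^ n) \<le> (2 * \<bar>t\<bar> ^ n / fact n) * \<bar>b\<bar> ^ n"
      by (intro mult_left_mono) auto
    with char_approx1[of n t] integrable show ?thesis
      by (simp add: moment_def power_mult_distrib)
  qed
  have "(\<lambda>n. 2 * ((\<bar>t\<bar> * \<bar>b\<bar>) ^ n / fact n)) \<longlonglongrightarrow> 2 * 0"
    using summable_LIMSEQ_zero[OF summable_exp[of "\<bar>t\<bar> * \<bar>b\<bar>"]]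
    by (intro tendsto_mult tendsto_const) (simp only: inverse_eq_divide mult.commute[of "1 / _"] times_divide_eq_right mult_1_right)
  then have lim: "(\<lambda>n. 2 * ((\<bar>t\<bar> * \<bar>b\<bar>) ^ n / fact n)) \<longlonglongrightarrow> 0"
    by (simp only: mult_zero_right)
  have "(\<lambda>n. char M t -
      (\<Sum>k\<le>n. (\<i> * complex_of_real t) ^ k / fact k * complex_of_real (moment M k))) \<longlonglongrightarrow> 0"
    by (rule Lim_null_comparison[OF always_eventually[OF allI[OF bound]] lim])
  from tendsto_diff[OF tendsto_const[of "char M t"] this] show ?thesis
    by simp
qed

lemma compact_law_eqI:
  assumes "compact_law M" "compact_law N" "\<And>n. moment M n = moment N n"
  shows "M = N"
proof (rule Levy_uniqueness)
  show "real_distribution M" "real_distribution N"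
    using assms(1,2)
    by (simp_all add: compact_law_def real_distribution_def real_distribution_axioms_def)
  show "char M = char N"
  proof
    fix t
    show "char M t = char N t"
      using char_compact_law[OF assms(1), of t] char_compact_law[OF assms(2), of t]
      unfolding assms(3) by (rule LIMSEQ_unique)
  qed
qed

section \<open>Primitives on the upper half plane\<close>

lemma has_real_derivative_Im_comp:
  assumes "(w has_vector_derivative w') (at t within T)" "(H has_field_derivative h) (at (w t))"
  shows "((\<lambda>t. Im (H (w t))) has_real_derivative Im (h * w')) (at t within T)"
proof -
  have "((H \<circ> w) has_vector_derivative w' * h) (at t within T)"
    using field_vector_diff_chain_within[OF assms(1)] assms(2) has_field_derivative_at_within by blast
  from bounded_linear.has_vector_derivative[OF bounded_linear_Im this] show ?thesis
    by (simp add: has_real_derivative_iff_has_vector_derivative mult.commute)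
qed

lemma Im_primitive_on_reals:
  assumes "convex S" "0 \<in> S" "Im (G 0) = 0"
    and G: "\<And>w. w \<in> S \<Longrightarrow> (G has_field_derivative g w) (at w)"
    and real: "\<And>t. complex_of_real t \<in> S \<Longrightarrow> Im (g (of_real t)) = 0"
    and "of_real t \<in> S"
  shows "Im (G (of_real t)) = 0"
proof -
  let ?T = "{t. complex_of_real t \<in> S}"
  have "convex ?T"
    using convex_linear_vimage[OF bounded_linear.linear[OF bounded_linear_of_real] \<open>convex S\<close>]
    by (simp add: vimage_def)
  moreover have "((\<lambda>t. Im (G (of_real t))) has_real_derivative 0) (at t within ?T)" if "t \<in> ?T" for t
  proof -
    have "(complex_of_real has_vector_derivative 1) (at t within ?T)"
      using has_vector_derivative_of_real[OF DERIV_ident] by simp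
    from has_real_derivative_Im_comp[OF this G] that real show ?thesis
      by simp
  qed
  ultimately obtain c where "\<And>t. t \<in> ?T \<Longrightarrow> Im (G (of_real t)) = c"
    using has_field_derivative_zero_constant[of ?T "\<lambda>t. Im (G (of_real t))"] by auto
  from this[of 0] this[of t] assms(2,3,6) show ?thesis
    by simp
qed

lemma divided_difference_at_0:
  fixes g :: "complex \<Rightarrow> complex"
  assumes "g holomorphic_on S" "open S" "0 \<in> S" "g has_fps_expansion F"
    and real: "\<And>t. complex_of_real t \<in> S \<Longrightarrow> Im (g (of_real t)) = 0"
  obtains g1 where "g1 holomorphic_on S" "g1 has_fps_expansion fps_shift 1 F"
    "\<And>w. w \<noteq> 0 \<Longrightarrow> g w = F $ 0 + w * g1 w"
    "\<And>t. complex_of_real t \<in> S \<Longrightarrow> Im (g1 (of_real t)) = 0"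
proof
  let ?g1 = "\<lambda>w. if w = 0 then F $ 1 else (g w - F $ 0) / w"
  have g0: "g 0 = F $ 0"
    using assms(4) by (rule has_fps_expansion_imp_0_eq_fps_nth_0)
  have "deriv g 0 = fps_deriv F $ 0"
    using has_fps_expansion_deriv[OF assms(4)] by (rule has_fps_expansion_imp_0_eq_fps_nth_0)
  then have g'0: "deriv g 0 = F $ 1"
    by simp
  show holo: "?g1 holomorphic_on S"
    using pole_lemma_open[OF assms(1,2), of 0] by (simp only: g'0 g0 diff_zero)
  from has_fps_expansion_fps_expansion[OF assms(2,3) holo]
  have E: "?g1 has_fps_expansion fps_expansion ?g1 0" .
  have "(\<lambda>w. F $ 0 + w * ?g1 w) has_fps_expansion fps_const (F $ 0) + fps_X * fps_expansion ?g1 0"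
    by (intro fps_expansion_intros E)
  moreover have "(\<lambda>w. F $ 0 + w * ?g1 w) = g"
    using g0 by auto
  ultimately have F_eq: "F = fps_const (F $ 0) + fps_X * fps_expansion ?g1 0"
    using assms(4) fps_expansion_unique_complex by metis
  have "F $ Suc n = fps_expansion ?g1 0 $ n" for n
    by (rule trans[OF arg_cong[OF F_eq, of "\<lambda>F. F $ Suc n"]]) simp
  then have "fps_shift 1 F = fps_expansion ?g1 0"
    by (intro fps_ext) simp
  with E show "?g1 has_fps_expansion fps_shift 1 F"
    by simp
  show "g w = F $ 0 + w * ?g1 w" if "w \<noteq> 0" for w
    using that by simp
  have "((\<lambda>t. Im (g (of_real t))) has_real_derivative Im (deriv g 0 * 1)) (at 0)"
    using assms(1-3) has_vector_derivative_of_real[OF DERIV_ident]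
    by (intro has_real_derivative_Im_comp) (auto intro!: holomorphic_derivI)
  moreover have "((\<lambda>t. Im (g (of_real t))) has_real_derivative 0) (at 0)"
  proof (rule has_field_derivative_transform_within_open[where f = "\<lambda>_. 0" and S = "complex_of_real -` S"])
    show "open (complex_of_real -` S)"
      by (intro open_vimage \<open>open S\<close> continuous_intros)
  qed (use assms(3) real in auto)
  ultimately have "Im (F $ 1) = 0"
    using DERIV_unique g'0 by fastforce
  moreover have "Im (F $ 0) = 0"
    using real[of 0] assms(3) g0 by simp
  ultimately show "Im (?g1 (of_real t)) = 0" if "of_real t \<in> S" for t
    using real[OF that] by (simp add: Im_divide_of_real)
qed

text \<open>
  A primitive of \<open>g w / w ^ (n + 1)\<close> on the upper half plane, for \<open>g\<close> real on the real line.  Its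
  imaginary part is \<open>0\<close> on the positive half line and \<open>\<pi>\<close> times the residue at the origin on the
  negative one: in the Laurent expansion, only the term in \<open>1 / w\<close> has a primitive, the logarithm,
  that is not real on both half lines.
\<close>

lemma primitive_half_residue:
  fixes g :: "complex \<Rightarrow> complex"
  assumes "open S" "convex S" "0 \<in> S" "g holomorphic_on S" "g has_fps_expansion F"
    and "\<And>t. complex_of_real t \<in> S \<Longrightarrow> Im (g (of_real t)) = 0"
  shows "\<exists>H. (\<forall>w\<in>S. 0 < Im w \<longrightarrow> (H has_field_derivative g w / w ^ Suc n) (at w)) \<and>
    (\<forall>t. of_real t \<in> S \<longrightarrow> t > 0 \<longrightarrow>
       ((\<lambda>w. Im (H w)) \<longlongrightarrow> 0) (at (of_real t) within {w. 0 < Im w})) \<and>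
    (\<forall>t. of_real t \<in> S \<longrightarrow> t < 0 \<longrightarrow>
       ((\<lambda>w. Im (H w)) \<longlongrightarrow> pi * Re (F $ n)) (at (of_real t) within {w. 0 < Im w}))"
  using assms(4-)
proof (induction n arbitrary: g F)
  case (0 g F)
  obtain g1 where g1: "g1 holomorphic_on S" "g1 has_fps_expansion fps_shift 1 F"
    "\<And>w. w \<noteq> 0 \<Longrightarrow> g w = F $ 0 + w * g1 w"
    "\<And>t. complex_of_real t \<in> S \<Longrightarrow> Im (g1 (of_real t)) = 0"
    using divided_difference_at_0[OF 0(1) assms(1,3) 0(2,3)] by blast
  obtain G where "\<And>w. w \<in> S \<Longrightarrow> (G has_field_derivative g1 w) (at w within S)"
    using holomorphic_convex_primitive'[OF assms(2,1) g1(1)] by blast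
  then have G': "(G has_field_derivative g1 w) (at w)" if "w \<in> S" for w
    using that at_within_open[OF that assms(1)] by metis
  define G0 where "G0 w = G w - G 0" for w
  have G0: "(G0 has_field_derivative g1 w) (at w)" if "w \<in> S" for w
    unfolding G0_def using G'[OF that] by (auto intro!: derivative_eq_intros)
  have G0_real: "Im (G0 (of_real t)) = 0" if "of_real t \<in> S" for t
    by (rule Im_primitive_on_reals[OF assms(2,3) _ G0 g1(4) that]) (auto simp: G0_def)
  have F0: "Im (F $ 0) = 0"
    using 0(3)[of 0] assms(3) has_fps_expansion_imp_0_eq_fps_nth_0[OF 0(2)] by simp
  \<comment> \<open>The branch of the logarithm that is cut along the negative imaginary axis.\<close>
  define L where "L w = Ln (- \<i> * w) + \<i> * (pi / 2)" for w
  define H where "H w = F $ 0 * L w + G0 w" for w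
  have L: "(L has_field_derivative 1 / w) (at w)" if "Im w \<ge> 0" "w \<noteq> 0" for w
  proof -
    have "- \<i> * w \<notin> \<real>\<^sub>\<le>\<^sub>0"
      using that by (auto simp: complex_nonpos_Reals_iff complex_eq_iff)
    then show ?thesis
      unfolding L_def using that by (auto intro!: derivative_eq_intros simp: field_simps)
  qed
  have lim: "((\<lambda>w. Im (H w)) \<longlongrightarrow> Im (H (of_real t))) (at (of_real t) within {w. 0 < Im w})"
    if "of_real t \<in> S" "t \<noteq> 0" for t
  proof -
    have "isCont H (of_real t)"
      unfolding H_def
      by (intro continuous_intros DERIV_isCont[OF L] DERIV_isCont[OF G0]) (use that in auto)
    then show ?thesis
      by (intro tendsto_intros) (auto simp: isCont_def intro: tendsto_within_subset)
  qed
  show ?case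
  proof (intro exI[of _ H] conjI ballI allI impI)
    fix w assume w: "w \<in> S" "0 < Im w"
    then have "w \<noteq> 0" by auto
    have "(H has_field_derivative F $ 0 * (1 / w) + g1 w) (at w)"
      unfolding H_def using w \<open>w \<noteq> 0\<close> by (intro DERIV_add DERIV_cmult L G0) auto
    then show "(H has_field_derivative g w / w ^ Suc 0) (at w)"
      using \<open>w \<noteq> 0\<close> by (simp add: g1(3) add_divide_distrib)
  next
    fix t :: real assume t: "of_real t \<in> S" "t > 0"
    have "Ln (- \<i> * of_real t) = of_real (ln t) - \<i> * (pi / 2)"
      using Ln_times_of_real[of t "- \<i>"] t by (simp add: Ln_of_real mult.commute)
    then have "Im (H (of_real t)) = 0"
      using t F0 G0_real by (simp add: H_def L_def)
    with lim[of t] t show "((\<lambda>w. Im (H w)) \<longlongrightarrow> 0) (at (of_real t) within {w. 0 < Im w})"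
      by simp
  next
    fix t :: real assume t: "of_real t \<in> S" "t < 0"
    have "Ln (- \<i> * of_real t) = of_real (ln (- t)) + \<i> * (pi / 2)"
      using Ln_times_of_real[of "- t" "\<i>"] Ln_of_real[of "- t"] t by (simp add: Ln_of_real mult.commute)
    then have "Im (H (of_real t)) = pi * Re (F $ 0)"
      using t F0 G0_real by (simp add: H_def L_def)
    with lim[of t] t show "((\<lambda>w. Im (H w)) \<longlongrightarrow> pi * Re (F $ 0)) (at (of_real t) within {w. 0 < Im w})"
      by simp
  qed
next
  case (Suc n g F)
  obtain g1 where g1: "g1 holomorphic_on S" "g1 has_fps_expansion fps_shift 1 F"
    "\<And>w. w \<noteq> 0 \<Longrightarrow> g w = F $ 0 + w * g1 w"
    "\<And>t. complex_of_real t \<in> S \<Longrightarrow> Im (g1 (of_real t)) = 0"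
    using divided_difference_at_0[OF Suc.prems(1) assms(1,3) Suc.prems(2,3)] by blast
  from Suc.IH[OF g1(1,2,4)] obtain H where
    H: "\<And>w. w \<in> S \<Longrightarrow> 0 < Im w \<Longrightarrow> (H has_field_derivative g1 w / w ^ Suc n) (at w)"
    and H_pos: "\<And>t. of_real t \<in> S \<Longrightarrow> t > 0 \<Longrightarrow>
       ((\<lambda>w. Im (H w)) \<longlongrightarrow> 0) (at (of_real t) within {w. 0 < Im w})"
    and H_neg: "\<And>t. of_real t \<in> S \<Longrightarrow> t < 0 \<Longrightarrow>
       ((\<lambda>w. Im (H w)) \<longlongrightarrow> pi * Re (fps_shift 1 F $ n)) (at (of_real t) within {w. 0 < Im w})"
    by blast
  have F0: "Im (F $ 0) = 0"
    using Suc.prems(3)[of 0] assms(3) has_fps_expansion_imp_0_eq_fps_nth_0[OF Suc.prems(2)] by simp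
  define R where "R w = - F $ 0 / of_nat (Suc n) * inverse w ^ Suc n" for w
  have R: "(R has_field_derivative F $ 0 / w ^ Suc (Suc n)) (at w)" if "w \<noteq> 0" for w
  proof -
    have "(R has_field_derivative - F $ 0 / of_nat (Suc n) *
        (of_nat (Suc n) * (- (inverse w ^ Suc (Suc 0)) * inverse w ^ (Suc n - Suc 0)))) (at w)"
      unfolding R_def by (rule DERIV_cmult[OF DERIV_power[OF DERIV_inverse[OF that]]])
    also have "- F $ 0 / of_nat (Suc n) *
        (of_nat (Suc n) * (- (inverse w ^ Suc (Suc 0)) * inverse w ^ (Suc n - Suc 0))) =
        F $ 0 * (inverse w ^ Suc (Suc 0) * inverse w ^ n)"
      by (simp del: of_nat_Suc power_Suc)
    also have "\<dots> = F $ 0 / w ^ Suc (Suc n)"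
      by (simp add: power_inverse divide_inverse)
    finally show ?thesis .
  qed
  have R_lim: "((\<lambda>w. Im (R w)) \<longlongrightarrow> 0) (at (of_real t) within {w. 0 < Im w})" if "t \<noteq> 0" for t
  proof -
    have "isCont R (of_real t)"
      by (rule DERIV_isCont[OF R]) (use that in simp)
    then have "((\<lambda>w. Im (R w)) \<longlongrightarrow> Im (R (of_real t))) (at (of_real t) within {w. 0 < Im w})"
      by (intro tendsto_intros) (auto simp: isCont_def intro: tendsto_within_subset)
    moreover have "R (of_real t) = F $ 0 * of_real (- (inverse t ^ Suc n) / real (Suc n))"
      by (simp add: R_def del: of_nat_Suc power_Suc)
    then have "Im (R (of_real t)) = 0"
      using F0 by (simp del: power_Suc of_nat_Suc)
    ultimately show ?thesis by simp
  qed
  show ?case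
  proof (intro exI[of _ "\<lambda>w. R w + H w"] conjI ballI allI impI)
    fix w assume w: "w \<in> S" "0 < Im w"
    then have "w \<noteq> 0" by auto
    then have "((\<lambda>w. R w + H w) has_field_derivative F $ 0 / w ^ Suc (Suc n) + g1 w / w ^ Suc n) (at w)"
      using w by (intro DERIV_add R H)
    also have "F $ 0 / w ^ Suc (Suc n) + g1 w / w ^ Suc n = g w / w ^ Suc (Suc n)"
      using \<open>w \<noteq> 0\<close> by (simp add: g1(3) add_divide_distrib)
    finally show "((\<lambda>w. R w + H w) has_field_derivative g w / w ^ Suc (Suc n)) (at w)" .
  next
    fix t :: real assume t: "of_real t \<in> S" "t > 0"
    with tendsto_add[OF R_lim[of t] H_pos[of t]]
    show "((\<lambda>w. Im (R w + H w)) \<longlongrightarrow> 0) (at (of_real t) within {w. 0 < Im w})"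
      by simp
  next
    fix t :: real assume t: "of_real t \<in> S" "t < 0"
    with tendsto_add[OF R_lim[of t] H_neg[of t]]
    show "((\<lambda>w. Im (R w + H w)) \<longlongrightarrow> pi * Re (F $ Suc n)) (at (of_real t) within {w. 0 < Im w})"
      by simp
  qed
qed

section \<open>The curve and the spectral variable\<close>

lemma c_par_bounds:
  assumes "r > 1"
  shows "1 < c_par r" "c_par r < 2"
proof -
  have r: "real r > 1" using assms by simp
  have "sqrt (real r ^ 2 + 8) < real r + 2"
    using r by (intro real_less_lsqrt) (auto simp: power2_eq_square algebra_simps)
  then show "1 < c_par r"
    using r by (simp add: c_par_def field_simps)
  have "4 - real r < sqrt (real r ^ 2 + 8)"
  proof (cases "r \<ge> 4")
    case True
    then have "4 - real r \<le> 0" by simp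
    also have "0 < sqrt (real r ^ 2 + 8)" by (simp add: add_nonneg_pos)
    finally show ?thesis .
  next
    case False
    then show ?thesis
      using r by (intro real_less_rsqrt) (auto simp: power2_eq_square algebra_simps)
  qed
  then show "c_par r < 2"
    using r by (simp add: c_par_def field_simps)
qed

lemma x_star_pos: "r > 1 \<Longrightarrow> 0 < x_star r"
  using c_par_bounds[of r] by (auto simp: x_star_def)

lemma sin_pos_multiples:
  assumes "r > 1" "\<phi> \<in> {0<..<pi / (real r + 1)}"
  shows "0 < sin \<phi>" "0 < sin ((real r - 1) * \<phi>)" "0 < sin (real r * \<phi>)"
    "0 < sin ((real r + 1) * \<phi>)" "0 < cos \<phi>" "\<phi> < pi / 2"
proof -
  have \<phi>: "0 < \<phi>" "(real r + 1) * \<phi> < pi"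
    using assms by (auto simp: field_simps)
  have "c * \<phi> \<le> (real r + 1) * \<phi>" if "c \<le> real r + 1" for c
    using that \<phi>(1) by (intro mult_right_mono) auto
  then have less: "c * \<phi> < pi" if "c \<le> real r + 1" for c
    using that \<phi>(2) by fastforce
  have sin: "0 < sin (c * \<phi>)" if "0 < c" "c \<le> real r + 1" for c
    using that \<phi>(1) less[of c] by (intro sin_gt_zero) auto
  show "0 < sin \<phi>" "0 < sin ((real r - 1) * \<phi>)" "0 < sin (real r * \<phi>)" "0 < sin ((real r + 1) * \<phi>)"
    using sin[of 1] sin[of "real r - 1"] sin[of "real r"] sin[of "real r + 1"] assms(1) by simp_all
  show "\<phi> < pi / 2"
    using less[of 2] assms(1) by simp
  with \<phi>(1) show "0 < cos \<phi>"
    by (intro cos_gt_zero_pi) auto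
qed

lemma sin_mult_sin_neighbours:
  "sin ((a - 1) * x) * sin ((a + 1) * x) = sin (a * x) ^ 2 - sin x ^ 2" for a x :: real
proof -
  have "sin (a * x - x) * sin (a * x + x) =
      sin (a * x) ^ 2 * cos x ^ 2 - cos (a * x) ^ 2 * sin x ^ 2"
    by (simp add: sin_diff sin_add power2_eq_square algebra_simps)
  also have "\<dots> = sin (a * x) ^ 2 - sin x ^ 2"
    by (simp add: cos_squared_eq algebra_simps)
  finally show ?thesis by (simp add: algebra_simps)
qed

lemma rho_eq:
  assumes "sin ((real r - 1) * \<phi>) > 0"
  shows "rho r \<phi> = (3 * sin (real r * \<phi>) - sqrt (sin (real r * \<phi>) ^ 2 + 8 * sin \<phi> ^ 2)) /
    (2 * sin ((real r - 1) * \<phi>))"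
proof -
  let ?m = "sin ((real r - 1) * \<phi>)" and ?p = "sin ((real r + 1) * \<phi>)" and ?s = "sin (real r * \<phi>)"
  have "(3 * ?s / (2 * ?m)) ^ 2 - 2 * ?p / ?m = (9 * ?s ^ 2 - 8 * (?m * ?p)) / (2 * ?m) ^ 2"
    using assms by (simp add: field_simps power2_eq_square)
  also have "\<dots> = (?s ^ 2 + 8 * sin \<phi> ^ 2) / (2 * ?m) ^ 2"
    by (simp only: sin_mult_sin_neighbours) simp
  also have "sqrt \<dots> = sqrt (?s ^ 2 + 8 * sin \<phi> ^ 2) / (2 * ?m)"
    using assms by (simp only: real_sqrt_divide real_sqrt_abs abs_of_pos mult_pos_pos zero_less_numeral)
  finally show ?thesis
    by (simp add: rho_def diff_divide_distrib)
qed

text \<open>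
  \<open>rho\<close> is the smaller root of a quadratic equation with positive roots.  The last inequality says
  that the curve stays in the half plane \<open>Re v < 3 / 2\<close>.
\<close>

lemma rho_props:
  assumes "r > 1" "\<phi> \<in> {0<..<pi / (real r + 1)}"
  shows rho_quadratic: "sin ((real r - 1) * \<phi>) * rho r \<phi> ^ 2 - 3 * sin (real r * \<phi>) * rho r \<phi> +
      2 * sin ((real r + 1) * \<phi>) = 0"
    and rho_pos: "0 < rho r \<phi>"
    and rho_cos_less: "2 * rho r \<phi> * cos \<phi> < 3"
proof -
  define m p s s1 c where "m = sin ((real r - 1) * \<phi>)" "p = sin ((real r + 1) * \<phi>)"
    "s = sin (real r * \<phi>)" "s1 = sin \<phi>" "c = cos \<phi>"
  note defs = this
  define D where "D = sqrt (s ^ 2 + 8 * s1 ^ 2)"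
  have pos: "0 < m" "0 < p" "0 < s" "0 < s1" "0 < c"
    using sin_pos_multiples[OF assms] by (simp_all add: defs)
  have mp: "m * p = s ^ 2 - s1 ^ 2"
    unfolding defs by (rule sin_mult_sin_neighbours)
  have \<rho>: "2 * m * rho r \<phi> = 3 * s - D"
    using pos(1) rho_eq[of r \<phi>] by (simp add: defs D_def)
  have D2: "D ^ 2 = s ^ 2 + 8 * s1 ^ 2" and D0: "0 \<le> D"
    by (simp_all add: D_def)
  have "4 * m * (m * rho r \<phi> ^ 2 - 3 * s * rho r \<phi> + 2 * p) =
      (2 * m * rho r \<phi>) ^ 2 - 6 * s * (2 * m * rho r \<phi>) + 8 * (m * p)"
    by (simp add: algebra_simps power2_eq_square)
  also have "\<dots> = 0"
    unfolding \<rho> mp using D2 by (simp add: algebra_simps power2_eq_square)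
  finally show "sin ((real r - 1) * \<phi>) * rho r \<phi> ^ 2 - 3 * sin (real r * \<phi>) * rho r \<phi> +
      2 * sin ((real r + 1) * \<phi>) = 0"
    using pos(1) by (simp add: defs)
  have s1s: "s1 ^ 2 < s ^ 2"
    using mp pos(1,2) by (metis diff_gt_0_iff_gt mult_pos_pos)
  then have "D ^ 2 < (3 * s) ^ 2"
    unfolding D2 by (simp add: power_mult_distrib)
  then have "D < 3 * s"
    using pos(3) by (intro power_less_imp_less_base[of D 2]) auto
  then have "0 < 2 * m * rho r \<phi>"
    by (simp add: \<rho>)
  then show "0 < rho r \<phi>"
    using pos(1) by (simp add: zero_less_mult_iff)
  have m_eq: "m = s * c - cos (real r * \<phi>) * s1"
    by (simp add: defs left_diff_distrib sin_diff)
  have c2: "c ^ 2 = 1 - s1 ^ 2" "cos (real r * \<phi>) ^ 2 = 1 - s ^ 2"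
    by (simp_all add: defs cos_squared_eq)
  \<comment> \<open>\<open>3 / (2 c)\<close> lies between the two roots of the quadratic equation.\<close>
  have "(3 * s * c - 3 * m) ^ 2 = 9 * (cos (real r * \<phi>) ^ 2 * s1 ^ 2)"
    by (simp add: m_eq power2_eq_square algebra_simps)
  also have "\<dots> < (c * D) ^ 2"
  proof -
    have "0 < (s ^ 2 - s1 ^ 2) * (1 + 8 * s1 ^ 2)"
      using s1s by (intro mult_pos_pos add_pos_nonneg) auto
    also have "\<dots> = (c * D) ^ 2 - 9 * (cos (real r * \<phi>) ^ 2 * s1 ^ 2)"
      unfolding power_mult_distrib D2 c2 by (simp add: algebra_simps)
    finally show ?thesis by simp
  qed
  finally have "3 * s * c - 3 * m < c * D"
    using pos D0 by (intro power_less_imp_less_base[of _ 2 "c * D"]) auto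
  then have "c * (2 * m * rho r \<phi>) < 3 * m"
    unfolding \<rho> by (simp add: algebra_simps)
  then have "m * (2 * rho r \<phi> * cos \<phi>) < m * 3"
    by (simp add: defs(5) mult_ac)
  then show "2 * rho r \<phi> * cos \<phi> < 3"
    using pos(1) mult_less_cancel_left_pos by blast
qed

text \<open>
  The radius is extended by its limit at \<open>\<phi> = 0\<close>, where the formula for \<open>rho\<close> divides by zero.
\<close>

definition rho_closed :: "nat \<Rightarrow> real \<Rightarrow> real" where
  "rho_closed r \<phi> = (if \<phi> = 0 then c_par r else rho r \<phi>)"

text \<open>The curve in the coordinate \<open>v\<close>, and in the coordinate \<open>w = 2 (v - 1) / (2 - v)\<close>.\<close>

definition v_curve :: "nat \<Rightarrow> real \<Rightarrow> complex" where
  "v_curve r \<phi> = of_real (rho_closed r \<phi>) * cis \<phi>"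

definition w_curve :: "nat \<Rightarrow> real \<Rightarrow> complex" where
  "w_curve r \<phi> = 2 * (v_curve r \<phi> - 1) / (2 - v_curve r \<phi>)"

text \<open>The spectral variable as a rational function of \<open>w\<close>, the reciprocal of \<open>\<chi>(w)\<close>.\<close>

definition x_map :: "nat \<Rightarrow> complex \<Rightarrow> complex" where
  "x_map r w = (1 + w) ^ (r + 1) / (w * (2 + w) ^ (r - 1))"

lemma rho_at_end:
  assumes "r > 1"
  shows "rho r (pi / (real r + 1)) = 0" "sin ((real r - 1) * (pi / (real r + 1))) > 0"
proof -
  define b where "b = pi / (real r + 1)"
  have "(real r + 1) * b = pi" by (simp add: b_def add_pos_nonneg)
  then have rb: "real r * b = pi - b"
    by (simp add: distrib_right)
  then have s: "sin (real r * b) = sin b" by simp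
  have b: "0 < b" "b < pi"
    using assms by (auto simp: b_def field_simps add_pos_nonneg)
  then have "0 < sin b" by (rule sin_gt_zero)
  have "(real r - 1) * b = pi - 2 * b"
    by (simp add: left_diff_distrib rb)
  moreover have "0 < (real r - 1) * b"
    using assms b by simp
  ultimately have "0 < (real r - 1) * b" "(real r - 1) * b < pi"
    using b by linarith+
  then have m: "sin ((real r - 1) * b) > 0"
    by (rule sin_gt_zero)
  have "sqrt (sin b ^ 2 + 8 * sin b ^ 2) = 3 * sin b"
    using \<open>0 < sin b\<close> by (intro real_sqrt_unique) (auto simp: power_mult_distrib)
  then have "rho r b = 0"
    using m by (simp add: rho_eq s)
  with m show "rho r (pi / (real r + 1)) = 0" "sin ((real r - 1) * (pi / (real r + 1))) > 0"
    by (simp_all only: b_def)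
qed

lemma rho_tendsto_0:
  assumes "r > 1"
  shows "(rho r \<longlongrightarrow> c_par r) (at 0 within {0<..<pi / (real r + 1)})"
proof -
  let ?F = "at 0 within {0<..<pi / (real r + 1)}"
  have lim: "((\<lambda>\<phi>. sin (k * \<phi>) / \<phi>) \<longlongrightarrow> k) ?F" for k :: real
  proof -
    have "((\<lambda>\<phi>. sin (k * \<phi>)) has_real_derivative k) (at 0)"
      by (auto intro!: derivative_eq_intros)
    then have "((\<lambda>\<phi>. sin (k * \<phi>) / \<phi>) \<longlongrightarrow> k) (at 0)"
      by (simp add: has_field_derivative_iff)
    then show ?thesis by (rule tendsto_within_subset) simp
  qed
  have "((\<lambda>\<phi>. (3 * (sin (real r * \<phi>) / \<phi>) -
      sqrt ((sin (real r * \<phi>) / \<phi>) ^ 2 + 8 * (sin (1 * \<phi>) / \<phi>) ^ 2)) /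
      (2 * (sin ((real r - 1) * \<phi>) / \<phi>))) \<longlongrightarrow>
      (3 * real r - sqrt (real r ^ 2 + 8 * 1 ^ 2)) / (2 * (real r - 1))) ?F"
    by (intro tendsto_intros lim) (use assms in auto)
  moreover have "\<forall>\<^sub>F \<phi> in ?F. (3 * (sin (real r * \<phi>) / \<phi>) -
      sqrt ((sin (real r * \<phi>) / \<phi>) ^ 2 + 8 * (sin (1 * \<phi>) / \<phi>) ^ 2)) /
      (2 * (sin ((real r - 1) * \<phi>) / \<phi>)) = rho r \<phi>"
    unfolding eventually_at_filter
  proof (rule always_eventually, intro allI impI)
    fix \<phi> assume \<phi>: "\<phi> \<in> {0<..<pi / (real r + 1)}"
    have "(sin (real r * \<phi>) / \<phi>) ^ 2 + 8 * (sin (1 * \<phi>) / \<phi>) ^ 2 =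
        (sin (real r * \<phi>) ^ 2 + 8 * sin \<phi> ^ 2) / \<phi> ^ 2"
      by (simp add: power_divide add_divide_distrib)
    then have "sqrt ((sin (real r * \<phi>) / \<phi>) ^ 2 + 8 * (sin (1 * \<phi>) / \<phi>) ^ 2) =
        sqrt (sin (real r * \<phi>) ^ 2 + 8 * sin \<phi> ^ 2) / \<phi>"
      using \<phi> by (simp add: real_sqrt_divide)
    then show "(3 * (sin (real r * \<phi>) / \<phi>) -
        sqrt ((sin (real r * \<phi>) / \<phi>) ^ 2 + 8 * (sin (1 * \<phi>) / \<phi>) ^ 2)) /
        (2 * (sin ((real r - 1) * \<phi>) / \<phi>)) = rho r \<phi>"
      using \<phi> sin_pos_multiples(2)[OF assms \<phi>] by (simp add: rho_eq field_simps)
  qed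
  ultimately have "(rho r \<longlongrightarrow> (3 * real r - sqrt (real r ^ 2 + 8 * 1 ^ 2)) / (2 * (real r - 1))) ?F"
    by (rule Lim_transform_eventually)
  then show ?thesis
    by (simp add: c_par_def)
qed

lemma DERIV_rho:
  assumes "r > 1" "\<phi> \<in> {0<..<pi / (real r + 1)}"
  obtains d where "(rho r has_real_derivative d) (at \<phi>)"
proof -
  let ?h = "\<lambda>\<phi>. (3 * sin (real r * \<phi>) - sqrt (sin (real r * \<phi>) ^ 2 + 8 * sin \<phi> ^ 2)) /
    (2 * sin ((real r - 1) * \<phi>))"
  have pos: "0 < sin (real r * \<phi>) ^ 2 + 8 * sin \<phi> ^ 2" "sin ((real r - 1) * \<phi>) \<noteq> 0"
    using sin_pos_multiples[OF assms] by (auto intro!: add_pos_pos)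
  have sin: "((\<lambda>\<phi>. sin (k * \<phi>)) has_real_derivative cos (k * \<phi>) * k) (at \<phi>)" for k
    by (auto intro!: derivative_eq_intros)
  have "((\<lambda>\<phi>. sin (real r * \<phi>) ^ 2 + 8 * sin \<phi> ^ 2) has_real_derivative
      (of_nat 2 * (cos (real r * \<phi>) * real r * sin (real r * \<phi>) ^ (2 - Suc 0)) +
       8 * (of_nat 2 * (cos \<phi> * sin \<phi> ^ (2 - Suc 0))))) (at \<phi>)"
    by (rule DERIV_add[OF DERIV_power[OF sin] DERIV_cmult[OF DERIV_power[OF DERIV_sin]]])
  note num = DERIV_diff[OF DERIV_cmult[OF sin[of "real r"]] DERIV_chain2[OF DERIV_real_sqrt[OF pos(1)] this]]
  have "2 * sin ((real r - 1) * \<phi>) \<noteq> 0"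
    using pos(2) by simp
  from DERIV_divide[OF num DERIV_cmult[OF sin] this]
  have "\<exists>d. (?h has_real_derivative d) (at \<phi>)"
    by (rule exI)
  then obtain d where "(?h has_real_derivative d) (at \<phi>)" ..
  then have "(rho r has_real_derivative d) (at \<phi>)"
    by (rule has_field_derivative_transform_within_open[where S = "{0<..<pi / (real r + 1)}"])
       (use assms sin_pos_multiples(2)[OF assms(1)] in \<open>auto simp: rho_eq\<close>)
  then show ?thesis by (rule that)
qed

lemma continuous_rho_closed:
  assumes "r > 1"
  shows "continuous_on {0..pi / (real r + 1)} (rho_closed r)"
  unfolding continuous_on_eq_continuous_within
proof
  let ?b = "pi / (real r + 1)"
  fix \<phi> assume \<phi>: "\<phi> \<in> {0..?b}"
  have b: "0 < ?b" by simp
  consider "\<phi> = 0" | "0 < \<phi>" by (use \<phi> in force)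
  then show "continuous (at \<phi> within {0..?b}) (rho_closed r)"
  proof cases
    case 1
    have "at 0 within {0..?b} = at 0 within {0<..<?b}"
      using b by (intro at_within_nhd[where S = "{..<?b}"]) auto
    moreover have "(rho_closed r \<longlongrightarrow> c_par r) (at 0 within {0<..<?b})"
      by (rule Lim_transform_within[OF rho_tendsto_0[OF assms], of 1]) (auto simp: rho_closed_def)
    ultimately show ?thesis
      by (simp add: 1 continuous_within rho_closed_def)
  next
    case 2
    have m: "0 < sin ((real r - 1) * \<phi>)"
      using sin_pos_multiples(2)[OF assms, of \<phi>] rho_at_end(2)[OF assms] \<phi> 2
      by (cases "\<phi> = ?b") auto
    have "isCont (rho r) \<phi>"
      unfolding rho_def using m by (intro continuous_intros) auto
    then have "isCont (rho_closed r) \<phi>"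
      by (rule continuous_transform_within[where \<delta> = \<phi>])
         (use 2 in \<open>auto simp: rho_closed_def dist_real_def\<close>)
    then show ?thesis by (rule continuous_at_imp_continuous_at_within)
  qed
qed


lemma x_map_moebius:
  assumes "r \<ge> 1" "v \<noteq> 1" "v \<noteq> 2"
  shows "x_map r (2 * (v - 1) / (2 - v)) = v ^ (r + 1) / (2 ^ r * ((v - 1) * (2 - v)))"
proof -
  obtain n where r: "r = Suc n" using assms(1) by (cases r) auto
  have nz: "2 - v \<noteq> 0" "v - 1 \<noteq> 0" using assms by auto
  have 1: "1 + 2 * (v - 1) / (2 - v) = v / (2 - v)"
    using nz(1) by (simp add: field_simps)
  have 2: "2 + 2 * (v - 1) / (2 - v) = 2 / (2 - v)"
    using nz(1) by (simp add: field_simps)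
  have "(v / y) ^ (Suc n + 1) / (2 * u / y * (2 / y) ^ (Suc n - 1)) = v ^ (Suc n + 1) / (2 ^ Suc n * (u * y))"
    if "y \<noteq> 0" for u y :: complex
    using that by (simp add: power_divide field_simps)
  from this[OF nz(1)] show ?thesis
    unfolding x_map_def 1 2 r .
qed

text \<open>
  On the curve the rational function takes the real value \<open>x_par\<close>, and the density is the imaginary
  part of \<open>w\<close> divided by \<open>\<pi> x\<close>.
\<close>

lemma curve_props:
  assumes r: "r > 1" and \<phi>: "\<phi> \<in> {0<..<pi / (real r + 1)}"
  shows Im_v_curve: "0 < Im (v_curve r \<phi>)"
    and x_map_w_curve: "x_map r (w_curve r \<phi>) = of_real (x_par r \<phi>)"
    and x_par_pos: "0 < x_par r \<phi>"
    and Im_w_curve: "0 < Im (w_curve r \<phi>)"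
    and density_par_eq: "density_par r \<phi> = Im (w_curve r \<phi>) / (pi * x_par r \<phi>)"
    and Re_w_curve: "-2 < Re (w_curve r \<phi>)"
proof -
  define \<rho> where "\<rho> = rho r \<phi>"
  define v where "v = v_curve r \<phi>"
  define T where "T = 3 * sin \<phi> - \<rho> * sin (2 * \<phi>)"
  define D where "D = 4 - 4 * \<rho> * cos \<phi> + \<rho> ^ 2"
  define sp where "sp = sin ((real r + 1) * \<phi>)"
  note sin_pos = sin_pos_multiples[OF r \<phi>]
  have \<rho>: "0 < \<rho>" "2 * \<rho> * cos \<phi> < 3"
    unfolding \<rho>_def by (rule rho_pos[OF r \<phi>] rho_cos_less[OF r \<phi>])+
  have v: "v = of_real \<rho> * cis \<phi>"
    using \<phi> by (simp add: v_def v_curve_def rho_closed_def \<rho>_def)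
  then have Re_v: "Re v = \<rho> * cos \<phi>" and Im_v: "Im v = \<rho> * sin \<phi>"
    by simp_all
  then show Im_v_pos: "0 < Im (v_curve r \<phi>)"
    using \<rho> sin_pos by (simp flip: v_def)
  then have nz: "v \<noteq> 1" "v \<noteq> 2" "2 - v \<noteq> 0"
    by (auto simp: v_def)
  have w: "w_curve r \<phi> = 2 * (v - 1) / (2 - v)"
    by (simp add: w_curve_def v_def)
  have T: "0 < T"
  proof -
    have "T = sin \<phi> * (3 - 2 * \<rho> * cos \<phi>)"
      by (simp only: T_def sin_double) (simp add: algebra_simps)
    then show ?thesis using \<rho> sin_pos by simp
  qed
  have sp: "0 < sp"
    using sin_pos by (simp add: sp_def)
  have x_par: "x_par r \<phi> = \<rho> ^ r * sp / (2 ^ r * T)"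
    by (simp add: x_par_def sp_def T_def \<rho>_def)
  show x_pos: "0 < x_par r \<phi>"
    unfolding x_par using \<rho> T sp by simp

  \<comment> \<open>The quadratic equation says that \<open>(v - 1) (2 - v)\<close> has the argument of \<open>v ^ (r + 1)\<close>.\<close>
  have key: "(v - 1) * (2 - v) * of_real sp = of_real (\<rho> * T) * cis ((real r + 1) * \<phi>)"
  proof (rule complex_eqI)
    have vv: "(v - 1) * (2 - v) = of_real (3 * \<rho>) * cis \<phi> - of_real (\<rho> ^ 2) * cis (2 * \<phi>) - 2"
      by (simp add: v algebra_simps power2_eq_square cis_mult)
    show "Im ((v - 1) * (2 - v) * of_real sp) = Im (of_real (\<rho> * T) * cis ((real r + 1) * \<phi>))"
      unfolding vv by (simp add: sp_def T_def algebra_simps power2_eq_square)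
    have "sp * (3 * \<rho> * cos \<phi> - \<rho> ^ 2 * cos (2 * \<phi>) - 2) - \<rho> * T * cos ((real r + 1) * \<phi>) =
        3 * \<rho> * (sp * cos \<phi> - cos ((real r + 1) * \<phi>) * sin \<phi>) -
        \<rho> ^ 2 * (sp * cos (2 * \<phi>) - cos ((real r + 1) * \<phi>) * sin (2 * \<phi>)) - 2 * sp"
      by (simp add: T_def algebra_simps power2_eq_square)
    also have "\<dots> = 3 * \<rho> * sin ((real r + 1) * \<phi> - \<phi>) - \<rho> ^ 2 * sin ((real r + 1) * \<phi> - 2 * \<phi>) - 2 * sp"
      by (simp only: sin_diff sp_def)
    also have "(real r + 1) * \<phi> - \<phi> = real r * \<phi>"
      by (simp add: algebra_simps)
    also have "(real r + 1) * \<phi> - 2 * \<phi> = (real r - 1) * \<phi>"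
      by (simp add: algebra_simps)
    also have "3 * \<rho> * sin (real r * \<phi>) - \<rho> ^ 2 * sin ((real r - 1) * \<phi>) - 2 * sp = 0"
      using rho_quadratic[OF r \<phi>] by (simp add: \<rho>_def sp_def algebra_simps)
    finally show "Re ((v - 1) * (2 - v) * of_real sp) = Re (of_real (\<rho> * T) * cis ((real r + 1) * \<phi>))"
      unfolding vv by (simp add: algebra_simps)
  qed
  have "v ^ (r + 1) = of_real (\<rho> ^ (r + 1)) * cis ((real r + 1) * \<phi>)"
    using Complex.DeMoivre[of \<phi> "r + 1"] by (simp only: v power_mult_distrib of_real_power of_nat_add of_nat_1)
  moreover have "(v - 1) * (2 - v) = of_real (\<rho> * T / sp) * cis ((real r + 1) * \<phi>)"
    using key sp by (simp add: field_simps)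
  ultimately have "v ^ (r + 1) / (2 ^ r * ((v - 1) * (2 - v))) =
      of_real (\<rho> ^ (r + 1)) / (2 ^ r * of_real (\<rho> * T / sp))"
    by (simp only: mult.assoc[symmetric]) (simp add: cis_neq_zero del: power_Suc)
  also have "\<dots> = of_real (x_par r \<phi>)"
    unfolding x_par using \<rho> T sp by (simp add: field_simps)
  finally show "x_map r (w_curve r \<phi>) = of_real (x_par r \<phi>)"
    using x_map_moebius[of r v] nz r by (simp add: w)

  have norm_v: "(2 - Re v) ^ 2 + Im v ^ 2 = D"
  proof -
    have "(2 - Re v) ^ 2 + Im v ^ 2 = 4 - 4 * \<rho> * cos \<phi> + (\<rho> ^ 2 * cos \<phi> ^ 2 + \<rho> ^ 2 * sin \<phi> ^ 2)"
      by (simp only: Re_v Im_v) (simp add: power2_eq_square algebra_simps)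
    then show ?thesis
      by (simp only: distrib_left[symmetric] sin_cos_squared_add2 D_def mult_1_right)
  qed
  have D: "0 < D"
    unfolding norm_v[symmetric] using Im_v_pos by (auto simp: v_def intro: add_nonneg_pos)
  have w2: "w_curve r \<phi> = 2 / (2 - v) - 2"
    unfolding w using nz(3) by (simp add: field_simps)
  have Im_w: "Im (w_curve r \<phi>) = 2 * \<rho> * sin \<phi> / D"
    unfolding w2 using norm_v by (simp add: Im_divide Im_v)
  show "0 < Im (w_curve r \<phi>)"
    unfolding Im_w using \<rho> sin_pos D by simp
  have "Re (w_curve r \<phi>) = 2 * (2 - \<rho> * cos \<phi>) / D - 2"
    unfolding w2 using norm_v by (simp add: Re_divide Re_v)
  moreover have "0 < 2 * (2 - \<rho> * cos \<phi>) / D"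
    using D \<rho> by simp
  ultimately show "-2 < Re (w_curve r \<phi>)"
    by linarith
  have "\<rho> ^ r = \<rho> * \<rho> ^ (r - 1)"
    using r by (cases r) auto
  have "density_par r \<phi> = 2 ^ (r + 1) * sin \<phi> * T / (pi * sp * \<rho> ^ (r - 1) * D)"
    by (simp add: density_par_def T_def D_def sp_def \<rho>_def)
  also have "\<dots> = (2 * \<rho> * sin \<phi> / D) / (pi * (\<rho> * \<rho> ^ (r - 1) * sp / (2 ^ r * T)))"
    using \<rho> T D sp by (simp add: field_simps)
  finally show "density_par r \<phi> = Im (w_curve r \<phi>) / (pi * x_par r \<phi>)"
    by (simp only: Im_w x_par \<open>\<rho> ^ r = \<rho> * \<rho> ^ (r - 1)\<close>)
qed

lemma v_curve_0: "v_curve r 0 = of_real (c_par r)"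
  by (simp add: v_curve_def rho_closed_def)

lemma v_curve_end: "r > 1 \<Longrightarrow> v_curve r (pi / (real r + 1)) = 0"
  using rho_at_end[of r] by (simp add: v_curve_def rho_closed_def add_nonneg_eq_0_iff)

lemma v_curve_avoids:
  assumes "r > 1" "\<phi> \<in> {0..pi / (real r + 1)}"
  shows "v_curve r \<phi> \<noteq> 1" "v_curve r \<phi> \<noteq> 2"
proof -
  consider "\<phi> = 0" | "\<phi> = pi / (real r + 1)" | "\<phi> \<in> {0<..<pi / (real r + 1)}"
    using assms(2) by force
  then have "v_curve r \<phi> \<noteq> 1 \<and> v_curve r \<phi> \<noteq> 2"
  proof cases
    case 1
    then show ?thesis
      using c_par_bounds[OF assms(1)] by (auto simp: v_curve_0 complex_eq_iff)
  next
    case 2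
    then show ?thesis
      using v_curve_end[OF assms(1)] by simp
  next
    case 3
    show ?thesis
      using Im_v_curve[OF assms(1) 3] by auto
  qed
  then show "v_curve r \<phi> \<noteq> 1" "v_curve r \<phi> \<noteq> 2"
    by auto
qed

lemma continuous_w_curve:
  assumes "r > 1"
  shows "continuous_on {0..pi / (real r + 1)} (w_curve r)"
proof -
  have "continuous_on {0..pi / (real r + 1)} (v_curve r)"
    unfolding v_curve_def
    by (intro continuous_intros continuous_rho_closed[OF assms])
  then show ?thesis
    unfolding w_curve_def
    using v_curve_avoids(2)[OF assms] by (intro continuous_intros) auto
qed

lemma w_curve_0: "w_curve r 0 = of_real (2 * (c_par r - 1) / (2 - c_par r))"
  by (simp add: w_curve_def v_curve_0)

lemma w_curve_end: "r > 1 \<Longrightarrow> w_curve r (pi / (real r + 1)) = -1"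
  by (simp add: w_curve_def v_curve_end)

text \<open>The spectral variable along the curve, continuous up to both end points.\<close>

definition x_closed :: "nat \<Rightarrow> real \<Rightarrow> real" where
  "x_closed r \<phi> = Re (x_map r (w_curve r \<phi>))"

lemma x_map_w_curve_closed:
  assumes "r > 1" "\<phi> \<in> {0..pi / (real r + 1)}"
  shows "x_map r (w_curve r \<phi>) =
    v_curve r \<phi> ^ (r + 1) / (2 ^ r * ((v_curve r \<phi> - 1) * (2 - v_curve r \<phi>)))"
  unfolding w_curve_def using assms v_curve_avoids[OF assms] by (intro x_map_moebius) auto

lemma x_closed_eq: "r > 1 \<Longrightarrow> \<phi> \<in> {0<..<pi / (real r + 1)} \<Longrightarrow> x_closed r \<phi> = x_par r \<phi>"
  by (simp add: x_closed_def x_map_w_curve)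

lemma x_closed_0: "r > 1 \<Longrightarrow> x_closed r 0 = x_star r"
proof -
  assume r: "r > 1"
  have "x_map r (w_curve r 0) = of_real (x_star r)"
    using x_map_w_curve_closed[OF r, of 0] by (simp add: v_curve_0 x_star_def mult.assoc)
  then show ?thesis by (simp add: x_closed_def)
qed

lemma x_closed_end: "r > 1 \<Longrightarrow> x_closed r (pi / (real r + 1)) = 0"
  using x_map_w_curve_closed[of r "pi / (real r + 1)"] by (simp add: v_curve_end x_closed_def)

lemma continuous_x_closed:
  assumes "r > 1"
  shows "continuous_on {0..pi / (real r + 1)} (x_closed r)"
proof -
  have "continuous_on {0..pi / (real r + 1)} (v_curve r)"
    unfolding v_curve_def by (intro continuous_intros continuous_rho_closed[OF assms])
  then have "continuous_on {0..pi / (real r + 1)} (\<lambda>\<phi>.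
      Re (v_curve r \<phi> ^ (r + 1) / (2 ^ r * ((v_curve r \<phi> - 1) * (2 - v_curve r \<phi>)))))"
    using v_curve_avoids[OF assms] by (intro continuous_intros) auto
  then show ?thesis
    by (rule continuous_on_eq) (simp add: x_closed_def x_map_w_curve_closed[OF assms])
qed

text \<open>The derivatives of powers are written with the logarithmic derivative split off.\<close>

lemma DERIV_power_log:
  fixes w c :: complex
  assumes "c + w \<noteq> 0"
  shows "((\<lambda>w. (c + w) ^ n) has_field_derivative (c + w) ^ n * (of_nat n / (c + w))) (at w)"
proof -
  have "((\<lambda>w. (c + w) ^ n) has_field_derivative of_nat n * (c + w) ^ (n - 1)) (at w)"
    by (auto intro!: derivative_eq_intros)
  moreover have "of_nat n * (c + w) ^ (n - 1) = (c + w) ^ n * (of_nat n / (c + w))"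
    using assms by (cases n) auto
  ultimately show ?thesis by simp
qed

lemma DERIV_x_map:
  assumes "w \<noteq> 0" "1 + w \<noteq> 0" "2 + w \<noteq> 0"
  shows "(x_map r has_field_derivative
    x_map r w * (of_nat (r + 1) / (1 + w) - 1 / w - of_nat (r - 1) / (2 + w))) (at w)"
proof -
  let ?P = "(1 + w) ^ (r + 1)" and ?Q = "w * (2 + w) ^ (r - 1)"
  let ?p = "of_nat (r + 1) / (1 + w)" and ?q = "1 / w + of_nat (r - 1) / (2 + w)"
  have "((\<lambda>w. w * (2 + w) ^ (r - 1)) has_field_derivative
      1 * (2 + w) ^ (r - 1) + (2 + w) ^ (r - 1) * (of_nat (r - 1) / (2 + w)) * w) (at w)"
    by (rule DERIV_mult[OF DERIV_ident DERIV_power_log[OF assms(3)]])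
  also have "1 * (2 + w) ^ (r - 1) + (2 + w) ^ (r - 1) * (of_nat (r - 1) / (2 + w)) * w = ?Q * ?q"
    using assms by (simp add: distrib_left)
  finally have Q: "((\<lambda>w. w * (2 + w) ^ (r - 1)) has_field_derivative ?Q * ?q) (at w)" .
  have nz: "?Q \<noteq> 0" using assms by simp
  have "(x_map r has_field_derivative (?P * ?p * ?Q - ?P * (?Q * ?q)) / (?Q * ?Q)) (at w)"
    unfolding x_map_def by (rule DERIV_divide[OF DERIV_power_log[OF assms(2)] Q nz])
  also have "(P * p * Q - P * (Q * q)) / (Q * Q) = P / Q * (p - q)" if "Q \<noteq> 0" for P p Q q :: complex
    using that by (simp add: field_simps)
  note this[OF nz, of ?P ?p ?q]
  finally show ?thesis
    by (simp only: x_map_def[abs_def] diff_diff_add)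
qed

text \<open>The critical points of \<open>x_map\<close> off its zeros and poles solve \<open>w\<^sup>2 + r w = 2\<close>, hence are real.\<close>

lemma x_map_deriv_nonzero:
  assumes "0 < Im w" "r > 0"
  shows "x_map r w * (of_nat (r + 1) / (1 + w) - 1 / w - of_nat (r - 1) / (2 + w)) \<noteq> 0"
proof -
  have nz: "w \<noteq> 0" "1 + w \<noteq> 0" "2 + w \<noteq> 0"
    using assms(1) by (auto simp: complex_eq_iff)
  have "of_nat (r + 1) / (1 + w) - 1 / w - of_nat (r - 1) / (2 + w) =
      (w ^ 2 + of_nat r * w - 2) / (w * (1 + w) * (2 + w))"
    using nz assms(2) by (simp add: divide_simps of_nat_diff) (simp add: algebra_simps power2_eq_square)
  moreover have "w ^ 2 + of_nat r * w - 2 \<noteq> 0"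
  proof
    assume "w ^ 2 + of_nat r * w - 2 = 0"
    then have "Re (w ^ 2 + of_nat r * w - 2) = 0" "Im (w ^ 2 + of_nat r * w - 2) = 0"
      by simp_all
    then have 1: "Re w ^ 2 - Im w ^ 2 + real r * Re w = 2" and 2: "Im w * (2 * Re w + real r) = 0"
      by (simp_all add: power2_eq_square algebra_simps)
    from 2 have "real r = - 2 * Re w"
      using assms(1) by simp
    with 1 have "- (Re w ^ 2) - Im w ^ 2 = 2"
      by (simp add: power2_eq_square)
    then show False
      using zero_le_power2[of "Re w"] zero_le_power2[of "Im w"] by linarith
  qed
  ultimately show ?thesis
    using nz by (simp add: x_map_def)
qed

lemma curve_derivatives:
  assumes r: "r > 1" and \<phi>: "\<phi> \<in> {0<..<pi / (real r + 1)}"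
  obtains w' d where "(w_curve r has_vector_derivative w') (at \<phi>)"
    "(x_par r has_real_derivative d) (at \<phi>)" "d \<noteq> 0"
    "of_real d = w' * deriv (x_map r) (w_curve r \<phi>)"
proof -
  let ?I = "{0<..<pi / (real r + 1)}"
  obtain \<rho>' where \<rho>': "(rho r has_real_derivative \<rho>') (at \<phi>)"
    using DERIV_rho[OF r \<phi>] .
  have "((\<lambda>\<phi>. of_real (rho r \<phi>) * cis \<phi>) has_vector_derivative
      of_real (rho r \<phi>) * (\<i> * cis \<phi>) + of_real \<rho>' * cis \<phi>) (at \<phi>)"
    by (intro has_vector_derivative_mult has_vector_derivative_of_real \<rho>')
       (auto simp: has_vector_derivative_def intro!: derivative_eq_intros)
  then have "(v_curve r has_vector_derivative
      of_real (rho r \<phi>) * (\<i> * cis \<phi>) + of_real \<rho>' * cis \<phi>) (at \<phi>)"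
    by (rule has_vector_derivative_transform_within_open[where S = ?I])
       (use \<phi> in \<open>auto simp: v_curve_def rho_closed_def\<close>)
  moreover define v' where "v' = of_real (rho r \<phi>) * (\<i> * cis \<phi>) + of_real \<rho>' * cis \<phi>"
  ultimately have v: "(v_curve r has_vector_derivative v') (at \<phi>)"
    by simp
  have "v' = Complex \<rho>' (rho r \<phi>) * cis \<phi>"
    by (simp add: v'_def complex_eq_iff algebra_simps)
  moreover have "Complex \<rho>' (rho r \<phi>) \<noteq> 0"
    using rho_pos[OF r \<phi>] by (simp add: complex_eq_iff)
  ultimately have v'_nz: "v' \<noteq> 0"
    by simp
  have v2: "2 - v_curve r \<phi> \<noteq> 0"
    using v_curve_avoids(2)[OF r, of \<phi>] \<phi> by auto
  then have "((\<lambda>v. 2 * (v - 1) / (2 - v)) has_field_derivative 2 / (2 - v_curve r \<phi>) ^ 2) (at (v_curve r \<phi>))"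
    by (auto intro!: derivative_eq_intros simp: power2_eq_square divide_simps)
  from field_vector_diff_chain_at[OF v this]
  have w: "(w_curve r has_vector_derivative v' * (2 / (2 - v_curve r \<phi>) ^ 2)) (at \<phi>)"
    by (simp add: w_curve_def[abs_def] o_def)
  define w' where "w' = v' * (2 / (2 - v_curve r \<phi>) ^ 2)"
  have w'_nz: "w' \<noteq> 0"
    using v'_nz v2 by (simp add: w'_def)
  have Im_w: "0 < Im (w_curve r \<phi>)"
    by (rule Im_w_curve[OF r \<phi>])
  then have "w_curve r \<phi> \<noteq> 0" "1 + w_curve r \<phi> \<noteq> 0" "2 + w_curve r \<phi> \<noteq> 0"
    by (auto simp: complex_eq_iff)
  note D = DERIV_x_map[OF this, of r]
  then have deriv: "(x_map r has_field_derivative deriv (x_map r) (w_curve r \<phi>)) (at (w_curve r \<phi>))"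
    "deriv (x_map r) (w_curve r \<phi>) \<noteq> 0"
    using x_map_deriv_nonzero[OF Im_w, of r] r by (auto simp: DERIV_imp_deriv)
  define D where "D = w' * deriv (x_map r) (w_curve r \<phi>)"
  have "((\<lambda>\<phi>. x_map r (w_curve r \<phi>)) has_vector_derivative D) (at \<phi>)"
    using field_vector_diff_chain_at[OF w deriv(1)] by (simp add: o_def D_def w'_def)
  then have D: "((\<lambda>\<phi>. of_real (x_par r \<phi>)) has_vector_derivative D) (at \<phi>)"
    by (rule has_vector_derivative_transform_within_open[where S = ?I])
       (use \<phi> x_map_w_curve[OF r] in auto)
  from bounded_linear.has_vector_derivative[OF bounded_linear_Re D]
  have x: "(x_par r has_real_derivative Re D) (at \<phi>)"
    by (simp add: has_real_derivative_iff_has_vector_derivative)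
  \<comment> \<open>The complex derivative \<open>D\<close> is real since \<open>x_par\<close> is, and nonzero by the chain rule.\<close>
  from bounded_linear.has_vector_derivative[OF bounded_linear_Im D]
  have "((\<lambda>_. 0) has_real_derivative Im D) (at \<phi>)"
    by (simp add: has_real_derivative_iff_has_vector_derivative)
  then have "Im D = 0"
    using DERIV_unique DERIV_const by blast
  then have D_real: "of_real (Re D) = D"
    by (simp add: complex_eq_iff)
  moreover have "D \<noteq> 0"
    using w'_nz deriv(2) by (simp add: D_def)
  ultimately have "Re D \<noteq> 0"
    by auto
  with w x D_real show ?thesis
    by (intro that[of w' "Re D"]) (auto simp: D_def w'_def)
qed

lemma x_closed_inj:
  assumes r: "r > 1"
  shows "inj_on (x_closed r) {0..pi / (real r + 1)}"
proof (rule linorder_inj_onI)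
  let ?b = "pi / (real r + 1)"
  fix s t assume st: "s < t" "s \<in> {0..?b}" "t \<in> {0..?b}"
  show "x_closed r s \<noteq> x_closed r t"
  proof
    assume eq: "x_closed r s = x_closed r t"
    have "\<exists>d. d \<noteq> 0 \<and> (x_closed r has_real_derivative d) (at \<phi>)" if "s < \<phi>" "\<phi> < t" for \<phi>
    proof -
      have \<phi>: "\<phi> \<in> {0<..<?b}" using that st by auto
      obtain d where "(x_par r has_real_derivative d) (at \<phi>)" "d \<noteq> 0"
        using curve_derivatives[OF r \<phi>] by metis
      moreover from this(1) have "(x_closed r has_real_derivative d) (at \<phi>)"
        by (rule has_field_derivative_transform_within_open[where S = "{0<..<?b}"])
           (use \<phi> in \<open>auto simp: x_closed_eq[OF r]\<close>)
      ultimately show ?thesis by blast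
    qed
    then obtain d where d: "\<And>\<phi>. s < \<phi> \<Longrightarrow> \<phi> < t \<Longrightarrow> d \<phi> \<noteq> 0 \<and> (x_closed r has_real_derivative d \<phi>) (at \<phi>)"
      by metis
    have "continuous_on {s..t} (x_closed r)"
      by (rule continuous_on_subset[OF continuous_x_closed[OF r]]) (use st in auto)
    from Rolle_deriv[OF st(1) eq this, of "\<lambda>\<phi>. (*) (d \<phi>)"] d
    obtain z where "s < z" "z < t" "(*) (d z) = (\<lambda>v. 0)"
      by (auto simp: has_field_derivative_def)
    then have "d z * 1 = 0" by metis
    with d \<open>s < z\<close> \<open>z < t\<close> show False by auto
  qed
qed auto

lemma x_closed_range:
  assumes r: "r > 1" and \<phi>: "\<phi> \<in> {0<..<pi / (real r + 1)}"
  shows "x_closed r \<phi> \<in> {0<..<x_star r}"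
proof -
  have "0 < \<phi>" "\<phi> < pi / (real r + 1)" using \<phi> by auto
  from continuous_inj_imp_mono[OF this continuous_x_closed[OF r] x_closed_inj[OF r]] x_star_pos[OF r]
  show ?thesis
    by (auto simp: x_closed_0[OF r] x_closed_end[OF r])
qed

lemma x_closed_image:
  assumes r: "r > 1"
  shows "x_closed r ` {0..pi / (real r + 1)} = {0..x_star r}"
proof
  let ?b = "pi / (real r + 1)"
  have b: "0 < ?b" by (simp add: add_nonneg_pos)
  show "x_closed r ` {0..?b} \<subseteq> {0..x_star r}"
  proof
    fix x assume "x \<in> x_closed r ` {0..?b}"
    then obtain \<phi> where \<phi>: "\<phi> \<in> {0..?b}" "x = x_closed r \<phi>" by auto
    then consider "\<phi> = 0" | "\<phi> = ?b" | "\<phi> \<in> {0<..<?b}" by force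
    then show "x \<in> {0..x_star r}"
      by cases (use \<phi> x_star_pos[OF r] x_closed_range[OF r] in \<open>auto simp: x_closed_0[OF r] x_closed_end[OF r] intro: less_imp_le\<close>)
  qed
  show "{0..x_star r} \<subseteq> x_closed r ` {0..?b}"
  proof
    fix x assume "x \<in> {0..x_star r}"
    then have "\<exists>\<phi>. 0 \<le> \<phi> \<and> \<phi> \<le> ?b \<and> x_closed r \<phi> = x"
      using b by (intro IVT2'[OF _ _ _ continuous_x_closed[OF r]]) (auto simp: x_closed_0[OF r] x_closed_end[OF r])
    then show "x \<in> x_closed r ` {0..?b}" by auto
  qed
qed

lemma bij_betw_x_par:
  assumes r: "r > 1"
  shows "bij_betw (x_par r) {0<..<pi / (real r + 1)} {0<..<x_star r}"
proof -
  let ?b = "pi / (real r + 1)"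
  have "x_closed r ` {0<..<?b} = {0<..<x_star r}"
  proof
    show "x_closed r ` {0<..<?b} \<subseteq> {0<..<x_star r}"
      using x_closed_range[OF r] by blast
    show "{0<..<x_star r} \<subseteq> x_closed r ` {0<..<?b}"
    proof
      fix x assume x: "x \<in> {0<..<x_star r}"
      then obtain \<phi> where \<phi>: "\<phi> \<in> {0..?b}" "x_closed r \<phi> = x"
        using x_closed_image[OF r] by (metis greaterThanLessThan_subseteq_atLeastAtMost_iff imageE order_refl subsetD)
      then have "\<phi> \<noteq> 0" "\<phi> \<noteq> ?b"
        using x x_closed_0[OF r] x_closed_end[OF r] by auto
      with \<phi> show "x \<in> x_closed r ` {0<..<?b}" by force
    qed
  qed
  moreover have "inj_on (x_closed r) {0<..<?b}"
    by (rule inj_on_subset[OF x_closed_inj[OF r]]) auto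
  ultimately have "bij_betw (x_closed r) {0<..<?b} {0<..<x_star r}"
    by (simp add: bij_betw_def)
  then show ?thesis
    by (subst bij_betw_cong[of _ "x_par r" "x_closed r"]) (simp_all add: x_closed_eq[OF r])
qed

section \<open>The residue at the origin\<close>

text \<open>
  \<open>(1 + w) \<chi>' / h\<close> in partial fractions, for \<open>\<chi> = w h = w (2 + w)^n / (1 + w)^(n + 2)\<close>.
\<close>

lemma chi_log_derivative:
  fixes h :: "complex fps"
  assumes h: "h = (2 + fps_X) ^ n * inverse (1 + fps_X) ^ (n + 2)"
  shows "(1 + fps_X) * fps_deriv (fps_X * h) * inverse h =
    - (fps_X - 1 + of_nat n * (fps_X * inverse (2 + fps_X)))"
proof -
  have h0: "h $ 0 \<noteq> 0"
    by (simp add: h fps_power_zeroth numeral_fps_const)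
  have hE: "h * inverse h = 1"
    by (rule inverse_mult_eq_1'[OF h0])
  have J: "(2 + fps_X) * inverse (2 + fps_X :: complex fps) = 1"
    by (rule inverse_mult_eq_1') (simp add: numeral_fps_const)
  have "h * (1 + fps_X) ^ (n + 2) = (2 + fps_X) ^ n * ((1 + fps_X) * inverse (1 + fps_X)) ^ (n + 2)"
    by (simp only: h power_mult_distrib mult_ac)
  then have hP: "h * (1 + fps_X) ^ (n + 2) = (2 + fps_X) ^ n"
    by (simp only: one_plus_X_inverse power_one mult_1_right)
  have d1: "fps_deriv ((1 + fps_X :: complex fps) ^ (n + 2)) = of_nat (n + 2) * (1 + fps_X) ^ (n + 1)"
  proof -
    have "n + 2 - 1 = n + 1" by simp
    then show ?thesis
      by (simp only: fps_deriv_power fps_of_nat fps_deriv_add fps_deriv_1 fps_deriv_fps_X add_0 mult_1_right)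
  qed
  have d2: "fps_deriv ((2 + fps_X :: complex fps) ^ n) * (2 + fps_X) = of_nat n * (2 + fps_X) ^ n"
  proof (cases n)
    case (Suc m)
    show ?thesis
      by (simp only: Suc fps_deriv_power fps_of_nat diff_Suc_1) (simp add: mult_ac del: of_nat_Suc)
  qed simp
  have "fps_deriv h * (1 + fps_X) ^ (n + 2) + h * (of_nat (n + 2) * (1 + fps_X) ^ (n + 1)) =
      fps_deriv ((2 + fps_X) ^ n)"
    unfolding hP[symmetric] fps_deriv_mult d1 by (simp only: add.commute)
  then have "(fps_deriv h * (1 + fps_X) ^ (n + 2) + h * (of_nat (n + 2) * (1 + fps_X) ^ (n + 1))) *
      ((1 + fps_X) * (2 + fps_X)) = (1 + fps_X) * (of_nat n * (h * (1 + fps_X) ^ (n + 2)))"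
    unfolding hP by (simp only: d2[symmetric] mult_ac)
  then have eq: "(1 + fps_X) ^ (n + 2) * (fps_deriv h * ((1 + fps_X) * (2 + fps_X)) + of_nat (n + 2) * (2 + fps_X) * h) =
      (1 + fps_X) ^ (n + 2) * (of_nat n * (1 + fps_X) * h)"
    by (simp add: algebra_simps)
  have "(1 + fps_X :: complex fps) ^ (n + 2) \<noteq> 0"
    using one_plus_X_inverse by (metis mult_zero_left power_not_zero zero_neq_one)
  from mult_left_cancel[THEN iffD1, OF this eq]
  have h': "fps_deriv h * ((1 + fps_X) * (2 + fps_X)) + of_nat (n + 2) * (2 + fps_X) * h =
      of_nat n * (1 + fps_X) * h" .
  have nz: "(2 + fps_X :: complex fps) \<noteq> 0"
    using J by auto
  have "(2 + fps_X) * ((1 + fps_X) * fps_deriv (fps_X * h)) =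
      h * ((2 + fps_X) * (1 + fps_X)) + fps_X * (fps_deriv h * ((1 + fps_X) * (2 + fps_X)))"
    by (simp add: algebra_simps)
  also have "fps_deriv h * ((1 + fps_X) * (2 + fps_X)) =
      of_nat n * (1 + fps_X) * h - of_nat (n + 2) * (2 + fps_X) * h"
    using h' by (simp add: eq_diff_eq)
  also have "h * ((2 + fps_X) * (1 + fps_X)) +
      fps_X * (of_nat n * (1 + fps_X) * h - of_nat (n + 2) * (2 + fps_X) * h) =
      h * ((2 + fps_X) - fps_X * (2 + fps_X) - of_nat n * fps_X)"
    by (simp add: algebra_simps)
  finally have "(2 + fps_X) * ((1 + fps_X) * fps_deriv (fps_X * h) * inverse h) =
      (h * inverse h) * ((2 + fps_X) - fps_X * (2 + fps_X) - of_nat n * fps_X)"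
    by (simp only: mult_ac)
  also have "\<dots> = (2 + fps_X) - fps_X * (2 + fps_X) - of_nat n * fps_X * ((2 + fps_X) * inverse (2 + fps_X))"
    by (simp only: hE J mult_1_left mult_1_right)
  also have "\<dots> = (2 + fps_X) * (- (fps_X - 1 + of_nat n * (fps_X * inverse (2 + fps_X))))"
    by (simp add: algebra_simps)
  finally have eq: "(2 + fps_X) * ((1 + fps_X) * fps_deriv (fps_X * h) * inverse h) = \<dots>" .
  from mult_left_cancel[THEN iffD1, OF nz eq] show ?thesis .
qed

text \<open>
  The function \<open>w^(k + 1) (1 + w) x(w)^(k - 1) x'(w)\<close> for \<open>x = x_map r\<close>, in a form that is visibly holomorphic
  away from \<open>w = -2\<close>; see \<open>moment_kernel_eq\<close> below.
\<close>

definition moment_kernel :: "nat \<Rightarrow> nat \<Rightarrow> complex \<Rightarrow> complex" where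
  "moment_kernel r k w = ((1 + w) ^ (r + 1) / (2 + w) ^ (r - 1)) ^ k * (w - 1 + of_nat (r - 1) * (w / (2 + w)))"

text \<open>The residue at the origin is the negative of the moment, by Lagrange inversion.\<close>

lemma moment_kernel_expansion:
  assumes r: "r > 1" and M: "M oo (fps_X * h) = 1 + fps_X"
    and h: "h = (2 + fps_X) ^ (r - 1) * inverse (1 + fps_X) ^ (r + 1)"
  obtains F where "moment_kernel r k has_fps_expansion F" "F $ k = - (M $ k)"
proof
  let ?F = "((1 + fps_X) ^ (r + 1) / (2 + fps_X) ^ (r - 1)) ^ k *
    (fps_X - 1 + of_nat (r - 1) * (fps_X / (2 + fps_X))) :: complex fps"
  have two: "(2 + fps_X :: complex fps) $ 0 \<noteq> 0" "((2 + fps_X :: complex fps) ^ (r - 1)) $ 0 \<noteq> 0"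
    by (simp_all add: numeral_fps_const fps_power_zeroth)
  show "moment_kernel r k has_fps_expansion ?F"
    unfolding moment_kernel_def[abs_def] fps_of_nat[symmetric]
    by (intro fps_expansion_intros has_fps_expansion_divide' two)
  have h0: "h $ 0 \<noteq> 0"
    by (simp add: h fps_power_zeroth numeral_fps_const)
  have "h * ((1 + fps_X) ^ (r + 1) / (2 + fps_X) ^ (r - 1)) =
      ((1 + fps_X) * inverse (1 + fps_X)) ^ (r + 1) * ((2 + fps_X) ^ (r - 1) * inverse ((2 + fps_X) ^ (r - 1)))"
    by (simp only: h fps_divide_unit[OF two(2)] power_mult_distrib mult_ac)
  also have "\<dots> = 1"
    by (simp only: one_plus_X_inverse inverse_mult_eq_1'[OF two(2)] power_one mult_1_right)
  finally have "(1 + fps_X) ^ (r + 1) / (2 + fps_X) ^ (r - 1) = inverse h"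
    using fps_inverse_unique by metis
  then have "?F = inverse h ^ k * (fps_X - 1 + of_nat (r - 1) * (fps_X * inverse (2 + fps_X)))"
    by (simp only: fps_divide_unit[OF two(1)])
  also have "\<dots> = - (inverse h ^ k * ((1 + fps_X) * fps_deriv (fps_X * h) * inverse h))"
  proof -
    have "r - 1 + 2 = r + 1" using r by simp
    then have "(1 + fps_X) * fps_deriv (fps_X * h) * inverse h =
        - (fps_X - 1 + of_nat (r - 1) * (fps_X * inverse (2 + fps_X)))"
      using h by (intro chi_log_derivative) (simp only:)
    then show ?thesis
      by (simp only: mult_minus_right minus_minus)
  qed
  also have "\<dots> = - ((1 + fps_X) * fps_deriv (fps_X * h) * inverse h ^ Suc k)"
    by (simp only: power_Suc mult_ac)
  finally show "?F $ k = - (M $ k)"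
    using lagrange_inversion[OF h0 M, of k] by (simp only: fps_neg_nth)
qed


lemma moment_kernel_holomorphic: "moment_kernel r k holomorphic_on {w. -2 < Re w}"
proof -
  have "2 + w \<noteq> 0" if "-2 < Re w" for w
    using that by (auto simp: complex_eq_iff)
  then show ?thesis
    unfolding moment_kernel_def[abs_def] by (intro holomorphic_intros) auto
qed

lemma Im_moment_kernel_of_real: "Im (moment_kernel r k (of_real t)) = 0"
proof -
  have "moment_kernel r k (of_real t) =
      of_real (((1 + t) ^ (r + 1) / (2 + t) ^ (r - 1)) ^ k * (t - 1 + of_nat (r - 1) * (t / (2 + t))))"
    by (simp add: moment_kernel_def)
  then show ?thesis by (simp only: Im_complex_of_real)
qed

lemma moment_kernel_eq:
  assumes "r > 1" "w \<noteq> 0" "1 + w \<noteq> 0" "2 + w \<noteq> 0"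
  shows "moment_kernel r k w / w ^ Suc k * x_map r w = x_map r w ^ k * ((1 + w) * deriv (x_map r) w)"
proof -
  define c :: complex where "c = of_nat (r - 1)"
  define B where "B = (1 + w) ^ (r + 1) / (2 + w) ^ (r - 1)"
  have x: "x_map r w = B / w"
    by (simp add: x_map_def B_def)
  have c: "of_nat (r + 1) = c + 2"
    using assms(1) by (simp add: c_def of_nat_diff)
  have log_deriv: "(w - 1 + c * (w / (2 + w))) / w = (1 + w) * ((c + 2) / (1 + w) - 1 / w - c / (2 + w))"
    using assms(2-) by (simp add: divide_simps) (simp add: algebra_simps)
  have "moment_kernel r k w / w ^ Suc k = (B / w) ^ k * ((w - 1 + c * (w / (2 + w))) / w)"
    by (simp add: moment_kernel_def B_def c_def power_divide power_mult_distrib)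
  also have "\<dots> = x_map r w ^ k * ((1 + w) * ((c + 2) / (1 + w) - 1 / w - c / (2 + w)))"
    by (simp only: x log_deriv)
  finally have "moment_kernel r k w / w ^ Suc k * x_map r w =
      x_map r w ^ k * ((1 + w) * (x_map r w * ((c + 2) / (1 + w) - 1 / w - c / (2 + w))))"
    by (simp only: mult_ac)
  also have "x_map r w * ((c + 2) / (1 + w) - 1 / w - c / (2 + w)) = deriv (x_map r) w"
    using DERIV_imp_deriv[OF DERIV_x_map[OF assms(2-), of r]] by (simp only: c c_def[symmetric])
  finally show ?thesis .
qed

section \<open>Identification of the measure\<close>

text \<open>
  The curve, traversed from \<open>w = -1\<close> to its positive end point, with \<open>x\<close> as the parameter.
\<close>

lemma curve_parametrised_by_x:
  assumes r: "r > 1"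
  obtains W :: "real \<Rightarrow> complex" and c0 :: real where
    "continuous_on {0..x_star r} W" "W 0 = -1" "W (x_star r) = of_real c0" "0 < c0"
    "\<And>x. x \<in> {0<..<x_star r} \<Longrightarrow> 0 < Im (W x)"
    "\<And>x. x \<in> {0<..<x_star r} \<Longrightarrow> -2 < Re (W x)"
    "\<And>x. x \<in> {0<..<x_star r} \<Longrightarrow> x_map r (W x) = of_real x"
    "\<And>x. x \<in> {0<..<x_star r} \<Longrightarrow>
       \<exists>W'. (W has_vector_derivative W') (at x) \<and> W' * deriv (x_map r) (W x) = 1"
    "\<And>\<phi>. \<phi> \<in> {0<..<pi / (real r + 1)} \<Longrightarrow> x_par r \<phi> \<in> {0<..<x_star r} \<and> W (x_par r \<phi>) = w_curve r \<phi>"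
proof -
  define b where "b = pi / (real r + 1)"
  define \<psi> where "\<psi> = the_inv_into {0..b} (x_closed r)"
  have b: "0 < b" by (simp add: b_def add_nonneg_pos)
  note inj = x_closed_inj[OF r, folded b_def]
  note image = x_closed_image[OF r, folded b_def]
  have \<psi>_x: "\<psi> (x_closed r \<phi>) = \<phi>" if "\<phi> \<in> {0..b}" for \<phi>
    unfolding \<psi>_def using inj that by (rule the_inv_into_f_f)
  have x_\<psi>: "x_closed r (\<psi> x) = x" "\<psi> x \<in> {0..b}" if "x \<in> {0..x_star r}" for x
    unfolding \<psi>_def using f_the_inv_into_f[OF inj] the_inv_into_into[OF inj _ order_refl] that image
    by blast+
  have \<psi>_ends: "\<psi> 0 = b" "\<psi> (x_star r) = 0"
    using \<psi>_x[of 0] \<psi>_x[of b] b x_closed_0[OF r] x_closed_end[OF r, folded b_def] by simp_all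
  have \<psi>_inner: "\<psi> x \<in> {0<..<b}" "x_par r (\<psi> x) = x" if "x \<in> {0<..<x_star r}" for x
  proof -
    have x: "x_closed r (\<psi> x) = x" "\<psi> x \<in> {0..b}"
      using x_\<psi>[of x] that by auto
    moreover have "\<psi> x \<noteq> 0" "\<psi> x \<noteq> b"
      using x(1) that x_closed_0[OF r] x_closed_end[OF r, folded b_def] by auto
    ultimately show "\<psi> x \<in> {0<..<b}" by auto
    then show "x_par r (\<psi> x) = x"
      using x(1) x_closed_eq[OF r, folded b_def] by simp
  qed
  have \<psi>_cont: "continuous_on {0..x_star r} \<psi>"
    using continuous_on_inv[OF continuous_x_closed[OF r, folded b_def], of \<psi>] \<psi>_x image by auto
  have \<psi>_isCont: "isCont \<psi> x" if "x \<in> {0<..<x_star r}" for x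
    using continuous_on_interior[OF \<psi>_cont, of x] that by simp
  have W_cont: "continuous_on {0..x_star r} (\<lambda>x. w_curve r (\<psi> x))"
    by (rule continuous_on_compose2[OF continuous_w_curve[OF r, folded b_def] \<psi>_cont]) (use x_\<psi> in auto)
  have deriv: "\<exists>W'. ((\<lambda>x. w_curve r (\<psi> x)) has_vector_derivative W') (at x) \<and>
      W' * deriv (x_map r) (w_curve r (\<psi> x)) = 1" if x: "x \<in> {0<..<x_star r}" for x
  proof -
    obtain w' d where w': "(w_curve r has_vector_derivative w') (at (\<psi> x))"
      and d: "(x_par r has_real_derivative d) (at (\<psi> x))" "d \<noteq> 0"
        "of_real d = w' * deriv (x_map r) (w_curve r (\<psi> x))"
      using curve_derivatives[OF r \<psi>_inner(1)[OF x, unfolded b_def]] .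
    have "(\<psi> has_real_derivative inverse d) (at x)"
      by (rule DERIV_inverse_function[where f = "x_par r" and g = \<psi> and a = 0 and b = "x_star r"])
         (use x d \<psi>_inner(2) \<psi>_isCont[OF x] in auto)
    then have "(\<psi> has_vector_derivative inverse d) (at x)"
      by (simp add: has_real_derivative_iff_has_vector_derivative)
    from vector_diff_chain_at[OF this w']
    have "((\<lambda>x. w_curve r (\<psi> x)) has_vector_derivative inverse d *\<^sub>R w') (at x)"
      by (simp add: o_def)
    moreover have "inverse d *\<^sub>R w' * deriv (x_map r) (w_curve r (\<psi> x)) = 1"
      using d(2) by (simp add: scaleR_conv_of_real mult.assoc flip: d(3))
    ultimately show ?thesis by blast
  qed
  show ?thesis
  proof (rule that[of "\<lambda>x. w_curve r (\<psi> x)" "2 * (c_par r - 1) / (2 - c_par r)"])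
    show "0 < 2 * (c_par r - 1) / (2 - c_par r)"
      using c_par_bounds[OF r] by simp
    show "x_par r \<phi> \<in> {0<..<x_star r} \<and> w_curve r (\<psi> (x_par r \<phi>)) = w_curve r \<phi>"
      if "\<phi> \<in> {0<..<pi / (real r + 1)}" for \<phi>
      using that x_closed_eq[OF r that] x_closed_range[OF r that] \<psi>_x[of \<phi>] by (auto simp: b_def)
  next
    fix x assume x: "x \<in> {0<..<x_star r}"
    note \<psi> = \<psi>_inner[OF x, unfolded b_def]
    show "0 < Im (w_curve r (\<psi> x))" "-2 < Re (w_curve r (\<psi> x))"
      "x_map r (w_curve r (\<psi> x)) = of_real x"
      using Im_w_curve[OF r \<psi>(1)] Re_w_curve[OF r \<psi>(1)] x_map_w_curve[OF r \<psi>(1)] \<psi>(2) by auto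
  qed (use W_cont deriv \<psi>_ends w_curve_0 w_curve_end[OF r] in \<open>simp_all add: b_def\<close>)
qed

text \<open>\<open>F k\<close> is a primitive of \<open>x ^ k * f x\<close>, so the moments are differences of its boundary values.\<close>

lemma density_compact_law:
  fixes f :: "real \<Rightarrow> real" and F :: "nat \<Rightarrow> real \<Rightarrow> real"
  assumes c: "0 < c" and f [measurable]: "f \<in> borel_measurable borel"
    and nonneg: "\<And>x. 0 \<le> f x" and zero: "\<And>x. x \<notin> {0<..<c} \<Longrightarrow> f x = 0"
    and cont: "\<And>x. x \<in> {0<..<c} \<Longrightarrow> isCont f x"
    and F: "\<And>k x. x \<in> {0<..<c} \<Longrightarrow> (F k has_real_derivative x ^ k * f x) (at x)"
    and F_0: "\<And>k. (F k \<longlongrightarrow> - m k) (at_right 0)"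
    and F_c: "\<And>k. (F k \<longlongrightarrow> 0) (at_left c)"
    and m_0: "m 0 = 1"
  shows "compact_law (density lborel (\<lambda>x. ennreal (f x)))"
    and "moment (density lborel (\<lambda>x. ennreal (f x))) k = m k"
proof -
  let ?M = "density lborel (\<lambda>x. ennreal (f x))"
  have power_f: "integrable lborel (\<lambda>x. x ^ k * f x)" "(\<integral>x. x ^ k * f x \<partial>lborel) = m k" for k
  proof -
    have interval: "einterval (ereal 0) (ereal c) = {0<..<c}"
      by (simp add: einterval_eq)
    have indicator: "indicat_real {0<..<c} x * (x ^ k * f x) = x ^ k * f x" for x
      using zero[of x] by (cases "x \<in> {0<..<c}") auto
    have "set_integrable lborel (einterval (ereal 0) (ereal c)) (\<lambda>x. x ^ k * f x)"
      "(LBINT x=ereal 0..ereal c. x ^ k * f x) = 0 - (- m k)"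
      by (rule interval_integral_FTC_nonneg[where F = "F k"];
          use c F[of _ k] F_0[of k] F_c[of k] nonneg in
            \<open>auto simp: ereal_tendsto_simps1 intro!: continuous_intros cont\<close>)+
    then show "integrable lborel (\<lambda>x. x ^ k * f x)" "(\<integral>x. x ^ k * f x \<partial>lborel) = m k"
      using c by (simp_all add: interval_lebesgue_integral_def set_integrable_def
            set_lebesgue_integral_def interval indicator)
  qed
  have "(\<integral>\<^sup>+x. ennreal (f x) \<partial>lborel) = ennreal (\<integral>x. f x \<partial>lborel)"
    using power_f(1)[of 0] nonneg by (intro nn_integral_eq_integral) auto
  also have "\<dots> = 1"
    using power_f(2)[of 0] m_0 by simp
  finally have "prob_space ?M"
    by (intro prob_spaceI) (simp add: emeasure_density)
  moreover have "AE x in ?M. 0 \<le> x \<and> x \<le> c"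
  proof -
    have "0 \<le> x \<and> x \<le> c" if "0 < f x" for x
      using zero[of x] that by (cases "x \<in> {0<..<c}") auto
    then show ?thesis by (simp add: AE_density)
  qed
  ultimately show "compact_law ?M"
    unfolding compact_law_def by auto
  show "moment ?M k = m k"
    unfolding moment_def using power_f(2)[of k] nonneg
    by (subst integral_density) (auto simp: mult.commute)
qed

lemma measure_support_density:
  fixes f :: "real \<Rightarrow> real"
  assumes c: "0 < c" and f [measurable]: "f \<in> borel_measurable borel"
    and pos: "\<And>x. x \<in> {0<..<c} \<Longrightarrow> 0 < f x" and zero: "\<And>x. x \<notin> {0<..<c} \<Longrightarrow> f x = 0"
  shows "measure_support (density lborel (\<lambda>x. ennreal (f x))) = {0..c}"
proof -
  let ?M = "density lborel (\<lambda>x. ennreal (f x))"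
  have null: "emeasure ?M U = 0 \<longleftrightarrow> U \<inter> {0<..<c} = {}" if U: "open U" for U
  proof
    assume "emeasure ?M U = 0"
    then have "U \<in> null_sets ?M"
      using U by (auto intro!: null_setsI)
    then have "AE x in lborel. x \<in> U \<longrightarrow> ennreal (f x) = 0"
      by (subst (asm) null_sets_density_iff) auto
    then have "AE x in lborel. x \<notin> U \<inter> {0<..<c}"
      by eventually_elim (use pos in fastforce)
    then have "U \<inter> {0<..<c} \<in> null_sets lborel"
      using U by (subst AE_iff_null_sets) auto
    then have "negligible (U \<inter> {0<..<c})"
      by (simp add: negligible_iff_null_sets null_sets_completionI)
    then show "U \<inter> {0<..<c} = {}"
      using open_Int[OF U open_greaterThanLessThan] open_not_negligible by blast
  next
    assume "U \<inter> {0<..<c} = {}"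
    then have "ennreal (f x) = 0" if "x \<in> U" for x
      using zero[of x] that by (metis disjoint_iff ennreal_0)
    then have "U \<in> null_sets ?M"
      using U by (subst null_sets_density_iff) auto
    then show "emeasure ?M U = 0" by auto
  qed
  have closure: "{0..c} = closure {0<..<c}"
    using c by simp
  show ?thesis
  proof (intro equalityI subsetI)
    fix x assume x: "x \<in> measure_support ?M"
    show "x \<in> {0..c}"
    proof (rule ccontr)
      assume "x \<notin> {0..c}"
      moreover have "open (- {0..c})" by auto
      ultimately have "emeasure ?M (- {0..c}) \<noteq> 0"
        using x unfolding measure_support_def by auto
      then show False
        using null[OF \<open>open (- {0..c})\<close>] by auto
    qed
  next
    fix x assume x: "x \<in> {0..c}"
    have "0 < emeasure ?M U" if "open U" "x \<in> U" for U
      using null[OF that(1)] x that open_Int_closure_eq_empty[OF that(1), of "{0<..<c}"]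
      unfolding closure by (auto simp: zero_less_iff_neq_zero)
    then show "x \<in> measure_support ?M"
      by (simp add: measure_support_def)
  qed
qed

theorem theorem3p1:
  fixes r :: nat and P A N \<mu> :: "real measure"
  assumes r: "r > 1"
    and P: "is_raney 2 1 P"
    and A: "is_raney 1 (1 / 2) A"
    and N: "is_free_mult_power A (r - 1) N"
    and mu: "is_free_mult_conv P N \<mu>"
  shows "1 < c_par r \<and> c_par r < 2 \<and> 0 < x_star r \<and>
    measure_support \<mu> = {0..x_star r} \<and>
    bij_betw (x_par r) {0<..<pi / (real r + 1)} {0<..<x_star r} \<and>
    (\<exists>f. f \<in> borel_measurable borel \<and>
         (\<forall>x. 0 \<le> f x) \<and>
         (\<forall>x. x \<notin> {0<..<x_star r} \<longrightarrow> f x = 0) \<and>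
         (\<forall>\<phi>\<in>{0<..<pi / (real r + 1)}. f (x_par r \<phi>) = density_par r \<phi>) \<and>
         \<mu> = density lborel (\<lambda>x. ennreal (f x)))"
proof -
  define h :: "complex fps" where "h = (2 + fps_X) ^ (r - 1) * inverse (1 + fps_X) ^ (r + 1)"
  have M: "moment_series \<mu> oo (fps_X * h) = 1 + fps_X"
  proof -
    have E: "inverse (1 + fps_X :: complex fps) ^ (r + 1) =
        inverse (1 + fps_X) ^ 2 * inverse (1 + fps_X) ^ (r - 1 + 1) * (1 + fps_X)"
    proof -
      have "inverse (1 + fps_X :: complex fps) ^ 2 * inverse (1 + fps_X) ^ (r - 1 + 1) * (1 + fps_X) =
          inverse (1 + fps_X) * inverse (1 + fps_X) ^ (r - 1 + 1) * ((1 + fps_X) * inverse (1 + fps_X))"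
        by (simp only: power2_eq_square mult_ac)
      then show ?thesis
        using r by (simp only: one_plus_X_inverse mult_1_right) simp
    qed
    have "fps_X * (fps_X * h) = (fps_X * inverse (1 + fps_X) ^ 2) *
        (fps_X * (2 + fps_X) ^ (r - 1) * inverse (1 + fps_X) ^ (r - 1 + 1)) * (1 + fps_X)"
      unfolding h_def E by (simp only: mult_ac)
    from moment_series_free_mult_conv[OF mu _ _ moment_series_raney_2_1[OF P]
        moment_series_power_raney_1_half[OF N A] this]
    show ?thesis by simp
  qed
  let ?S = "{w. -2 < Re w}"
  have S: "open ?S" "convex ?S" "0 \<in> ?S"
    by (auto intro: open_halfspace_Re_gt convex_halfspace_Re_gt)
  have "\<exists>H. (\<forall>w\<in>?S. 0 < Im w \<longrightarrow> (H has_field_derivative moment_kernel r k w / w ^ Suc k) (at w)) \<and>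
      (\<forall>t. of_real t \<in> ?S \<longrightarrow> t > 0 \<longrightarrow>
         ((\<lambda>w. Im (H w)) \<longlongrightarrow> 0) (at (of_real t) within {w. 0 < Im w})) \<and>
      (\<forall>t. of_real t \<in> ?S \<longrightarrow> t < 0 \<longrightarrow>
         ((\<lambda>w. Im (H w)) \<longlongrightarrow> - (pi * moment \<mu> k)) (at (of_real t) within {w. 0 < Im w}))" for k
  proof -
    obtain F where F: "moment_kernel r k has_fps_expansion F" "F $ k = - (moment_series \<mu> $ k)"
      using moment_kernel_expansion[OF r M h_def] .
    then have "pi * Re (F $ k) = - (pi * moment \<mu> k)"
      by simp
    with primitive_half_residue[OF S moment_kernel_holomorphic F(1) Im_moment_kernel_of_real, of k] show ?thesis
      by (simp only:)
  qed
  then obtain H where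
    H: "\<And>k w. w \<in> ?S \<Longrightarrow> 0 < Im w \<Longrightarrow> (H k has_field_derivative moment_kernel r k w / w ^ Suc k) (at w)"
    and H_pos: "\<And>k t. of_real t \<in> ?S \<Longrightarrow> t > 0 \<Longrightarrow>
         ((\<lambda>w. Im (H k w)) \<longlongrightarrow> 0) (at (of_real t) within {w. 0 < Im w})"
    and H_neg: "\<And>k t. of_real t \<in> ?S \<Longrightarrow> t < 0 \<Longrightarrow>
         ((\<lambda>w. Im (H k w)) \<longlongrightarrow> - (pi * moment \<mu> k)) (at (of_real t) within {w. 0 < Im w})"
    by metis
  define c where "c = x_star r"
  have c: "0 < c" unfolding c_def by (rule x_star_pos[OF r])
  obtain W :: "real \<Rightarrow> complex" and c0 :: real where
    W: "continuous_on {0..c} W" "W 0 = -1" "W c = of_real c0" "0 < c0"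
    and Im_W: "\<And>x. x \<in> {0<..<c} \<Longrightarrow> 0 < Im (W x)"
    and Re_W: "\<And>x. x \<in> {0<..<c} \<Longrightarrow> -2 < Re (W x)"
    and x_W: "\<And>x. x \<in> {0<..<c} \<Longrightarrow> x_map r (W x) = of_real x"
    and W': "\<And>x. x \<in> {0<..<c} \<Longrightarrow>
       \<exists>W'. (W has_vector_derivative W') (at x) \<and> W' * deriv (x_map r) (W x) = 1"
    and W_x: "\<And>\<phi>. \<phi> \<in> {0<..<pi / (real r + 1)} \<Longrightarrow> x_par r \<phi> \<in> {0<..<c} \<and> W (x_par r \<phi>) = w_curve r \<phi>"
    using curve_parametrised_by_x[OF r, folded c_def] by blast
  define f where "f x = indicat_real {0<..<c} x * (Im (W x) / (pi * x))" for x
  have f_in: "f x = Im (W x) / (pi * x)" if "x \<in> {0<..<c}" for x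
    using that by (simp add: f_def)
  have f_out: "f x = 0" if "x \<notin> {0<..<c}" for x
    using that by (auto simp: f_def)
  have f_pos: "0 < f x" if "x \<in> {0<..<c}" for x
    using that Im_W[OF that] f_in[OF that] by simp
  then have f_nonneg: "0 \<le> f x" for x
    using f_out[of x] by (cases "x \<in> {0<..<c}") (auto intro: less_imp_le)
  have cont: "continuous_on {0<..<c} (\<lambda>x. Im (W x) / (pi * x))"
    by (intro continuous_intros continuous_on_subset[OF W(1)]) auto
  have f_meas: "f \<in> borel_measurable borel"
    unfolding f_def[abs_def] using borel_measurable_continuous_on_indicator[OF _ cont] by simp
  have f_cont: "isCont f x" if "x \<in> {0<..<c}" for x
  proof -
    have "continuous_on {0<..<c} f"
      using cont by (rule continuous_on_eq) (simp add: f_in)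
    then show ?thesis
      using that by (simp add: continuous_on_eq_continuous_at)
  qed
  \<comment> \<open>\<open>H k\<close> has the derivative \<open>x ^ (k - 1) (1 + w) x'(w)\<close>, and \<open>x'(W x) W'(x) = 1\<close>.\<close>
  define F where "F k x = Im (H k (W x)) / pi" for k x
  have F: "(F k has_real_derivative x ^ k * f x) (at x)" if x: "x \<in> {0<..<c}" for k x
  proof -
    let ?w = "W x"
    obtain W' where W': "(W has_vector_derivative W') (at x)" "W' * deriv (x_map r) ?w = 1"
      using W'[OF x] by blast
    have nz: "?w \<noteq> 0" "1 + ?w \<noteq> 0" "2 + ?w \<noteq> 0"
      using Im_W[OF x] by (auto simp: complex_eq_iff)
    have "moment_kernel r k ?w / ?w ^ Suc k * of_real x = of_real x ^ k * ((1 + ?w) * deriv (x_map r) ?w)"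
      using moment_kernel_eq[OF r nz, of k] by (simp only: x_W[OF x])
    then have "moment_kernel r k ?w / ?w ^ Suc k * W' * of_real x =
        of_real x ^ k * ((1 + ?w) * deriv (x_map r) ?w) * W'"
      by (simp only: mult_ac)
    also have "\<dots> = of_real x ^ k * (1 + ?w) * (W' * deriv (x_map r) ?w)"
      by (simp only: mult_ac)
    also have "\<dots> = of_real (x ^ k) * (1 + ?w)"
      by (simp add: W'(2))
    finally have "moment_kernel r k ?w / ?w ^ Suc k * W' = of_real (x ^ k) * (1 + ?w) / of_real x"
      using x by (simp add: eq_divide_eq)
    then have "Im (moment_kernel r k ?w / ?w ^ Suc k * W') / pi = x ^ k * f x"
      by (simp add: f_in[OF x] Im_divide_of_real)
    moreover have "((\<lambda>x. Im (H k (W x))) has_real_derivative Im (moment_kernel r k ?w / ?w ^ Suc k * W')) (at x)"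
      using W'(1) by (rule has_real_derivative_Im_comp) (use H Re_W[OF x] Im_W[OF x] in simp)
    ultimately show ?thesis
      unfolding F_def using DERIV_cdivide by metis
  qed
  have F_0: "(F k \<longlongrightarrow> - moment \<mu> k) (at_right 0)" for k
  proof -
    have "eventually (\<lambda>x. x \<in> {0<..<c}) (at_right 0)"
      using c by (simp add: eventually_at_right_field) blast
    then have "eventually (\<lambda>x. W x \<in> {w. 0 < Im w} \<and> W x \<noteq> -1) (at_right 0)"
      by eventually_elim (use Im_W in fastforce)
    moreover have "(W \<longlongrightarrow> -1) (at_right 0)"
      using continuous_on_Icc_at_rightD[OF W(1) c] by (simp add: W(2))
    ultimately have "filterlim W (at (-1) within {w. 0 < Im w}) (at_right 0)"
      by (simp add: filterlim_at)
    from filterlim_compose[OF H_neg[of "-1" k, simplified] this]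
    have "((\<lambda>x. Im (H k (W x)) / pi) \<longlongrightarrow> - (pi * moment \<mu> k) / pi) (at_right 0)"
      by (intro tendsto_intros) auto
    then show ?thesis
      by (simp add: F_def[abs_def])
  qed
  have F_c: "(F k \<longlongrightarrow> 0) (at_left c)" for k
  proof -
    have "eventually (\<lambda>x. x \<in> {0<..<c}) (at_left c)"
      using c by (simp add: eventually_at_left_field) blast
    then have "eventually (\<lambda>x. W x \<in> {w. 0 < Im w} \<and> W x \<noteq> of_real c0) (at_left c)"
      by eventually_elim (use Im_W in fastforce)
    moreover have "(W \<longlongrightarrow> of_real c0) (at_left c)"
      using continuous_on_Icc_at_leftD[OF W(1) c] by (simp add: W(3))
    ultimately have "filterlim W (at (of_real c0) within {w. 0 < Im w}) (at_left c)"
      by (simp add: filterlim_at)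
    from filterlim_compose[OF H_pos[of c0 k] this] W(4)
    have "((\<lambda>x. Im (H k (W x)) / pi) \<longlongrightarrow> 0 / pi) (at_left c)"
      by (intro tendsto_intros) auto
    then show ?thesis
      by (simp add: F_def[abs_def])
  qed
  have mu_law: "compact_law \<mu>"
    using mu by (simp add: is_free_mult_conv_def)
  then interpret prob_space \<mu>
    by (simp add: compact_law_def)
  have "moment \<mu> 0 = 1"
    by (simp add: moment_def prob_space)
  note law = density_compact_law[where F = F and m = "moment \<mu>", OF c f_meas f_nonneg f_out f_cont F F_0 F_c this]
  have mu_eq: "\<mu> = density lborel (\<lambda>x. ennreal (f x))"
    by (rule compact_law_eqI[OF mu_law law(1) law(2)[symmetric]])
  have "measure_support \<mu> = {0..c}"
    unfolding mu_eq by (rule measure_support_density[OF c f_meas f_pos f_out])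
  moreover have "f (x_par r \<phi>) = density_par r \<phi>" if "\<phi> \<in> {0<..<pi / (real r + 1)}" for \<phi>
    using W_x[OF that] f_in density_par_eq[OF r that] by simp
  ultimately show ?thesis
    using c_par_bounds[OF r] c f_meas f_nonneg f_out mu_eq bij_betw_x_par[OF r]
    unfolding c_def by blast
qed

end
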